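(* Let $x > 2$. Then $$\sum_{n \leq x} m^2(n) = x + 3 \gamma_{0,2}\, x^{1/2} + (3 \gamma_{1,2} + 5 \gamma_{0,3})\, x^{1/3} + O(x^{1/4}),$$ where $\gamma_{0,2} = \zeta(3/2)/\zeta(3)$, $\gamma_{1,2} = \zeta(2/3)/\zeta(2)$, and $\gamma_{0,3} = \prod_p \left(1 + p^{-4/3} + p^{-5/3}\right)$, the product running over all primes.
   Context: For a natural number $n > 1$ with prime factorization $n = p_1^{\alpha_1} \cdots p_r^{\alpha_r}$ (distinct primes $p_i$, exponents $\alpha_i \geq 1$), $m(n) = \min\{\alpha_1, \ldots, \alpha_r\}$ is the minimum exponent of any prime power dividing $n$; by convention $m(1) = 1$. $\zeta$ denotes the Riemann zeta function. *)

theory Defs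
  imports
    "HOL-Complex_Analysis.Complex_Analysis"
    "HOL-Computational_Algebra.Computational_Algebra"
begin

text \<open>
  The Riemann zeta function: the value at \<open>s\<close> of the holomorphic continuation of the Dirichlet
  series to a punctured half-plane \<open>{z. c < Re z} - {1}\<close> containing \<open>s\<close>. By the identity theorem
  this value depends neither on \<open>c\<close> nor on the continuation. The value at the pole \<open>s = 1\<close> is
  unspecified.
\<close>
definition riemann_zeta :: "complex \<Rightarrow> complex" where
  "riemann_zeta s = (THE w. \<exists>c f. c < Re s \<and>
     f holomorphic_on ({z. c < Re z} - {1}) \<and>
     (\<forall>z. 1 < Re z \<longrightarrow> f z = (\<Sum>n. 1 / of_nat (Suc n) powr z)) \<and>
     f s = w)"

definition min_exponent :: "nat \<Rightarrow> nat" where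
  "min_exponent n =
     (if n > 1 then Min ((\<lambda>p. multiplicity p n) ` prime_factors n) else 1)"

definition gamma_0_2 :: complex where
  "gamma_0_2 = riemann_zeta (3 / 2) / riemann_zeta 3"

definition gamma_1_2 :: complex where
  "gamma_1_2 = riemann_zeta (2 / 3) / riemann_zeta 2"

definition gamma_0_3 :: real where
  "gamma_0_3 = (\<Prod>p. if prime p
     then 1 + real p powr (- (4 / 3)) + real p powr (- (5 / 3)) else 1)"

end

(*
  Write m(n)^2 = 1 + 3 [m(n) >= 2] + 5 [m(n) >= 3] + rest, where the rest is at most 7 if
  m(n) = 4 and O(log^2 n) if m(n) >= 5.  So the sum of m(n)^2 is governed by the counting functions
  N_k of the k-full numbers.

  Every k-full n is uniquely r a^k with all exponents of r strictly between k and 2k, so N_k(x) is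
  the sum of floor((x/r)^(1/k)) over such r.  Comparing the sum of r^(-1/k) with an Euler
  product gives N_k(x) = O(x^(1/k)) for k = 4, 5, and, since these r are (k+1)-full, the asymptotics
  of N_3 with error O(x^(1/4)).

  For N_2 the hyperbola method applies to T(y) = #{(a,b). a^2 b^3 <= y}, with zeta(2/3) arising from
  the partial sums of n^(-2/3); then T(x) is the sum of N_2(x/d^6) over d, and Moebius inversion
  of the error terms gives N_2 with error O(x^(1/5)).
*)
theory Submission
  imports Defs
begin

section \<open>The Riemann zeta function\<close>

text \<open>The error exponent comes from the 4-full numbers: there are about x^(1/4) of them and
  they are not expanded further, so N_2 and N_3 are needed only to that precision. The obstacle is
  N_2. For k = 3, replacing the floors by their arguments costs at most 1 for each r <= x, which is
  O(x^(1/4)) in total. For k = 2 the numbers r are the cubes of squarefree numbers, about x^(1/3) of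
  them, so the same step would lose as much as the secondary term itself. Hence the hyperbola method
  there. The constants come from Dirichlet series. That of the square-full numbers is zeta(2s)
  zeta(3s) / zeta(6s), whose poles at s = 1/2 and s = 1/3 give \<open>gamma_0_2\<close> and
  \<open>gamma_1_2\<close>. That of the cube-full numbers is zeta(3s) times the product over p of 1
  + p^(-4s) + p^(-5s), and this product is \<open>gamma_0_3\<close> at s = 1/3. As 2/3 lies outside
  the region of convergence of the series for zeta, a continuation to Re z > 0 is constructed and
  identified with \<open>riemann_zeta\<close>.\<close>

text \<open>The summand is \<open>m powr (-z)\<close> minus the integral of \<open>t powr (-z)\<close> over \<open>[m, m + 1]\<close>, for
  \<open>m = Suc n\<close>; the integrals sum to \<open>1 / (z - 1)\<close> when \<open>Re z > 1\<close>.\<close>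
definition zeta_summand :: "nat \<Rightarrow> complex \<Rightarrow> complex" where
  "zeta_summand n z = 1 / of_nat (Suc n) powr z
     - (of_nat (Suc (Suc n)) powr (1 - z) - of_nat (Suc n) powr (1 - z)) / (1 - z)"

definition zeta_continuation :: "complex \<Rightarrow> complex" where
  "zeta_continuation z = 1 / (z - 1) + (\<Sum>n. zeta_summand n z)"

text \<open>The mean value inequality is applied twice on the segment from m to m + 1: to t^(-z),
  whose derivative is at most |z| m^(-Re z - 1) there, and then to the primitive \<open>h\<close> of
  m^(-z) - t^(-z), whose increment over the segment is the summand.\<close>

lemma norm_zeta_summand_le:
  assumes z: "Re z > 0" "z \<noteq> 1"
  shows "norm (zeta_summand n z) \<le> norm z * real (Suc n) powr (- Re z - 1)"
proof -
  define m where "m = real (Suc n)"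
  have m: "m > 0" by (simp add: m_def)
  define S where "S = closed_segment (complex_of_real m) (of_real (m + 1))"
  have S: "\<exists>u. t = of_real u \<and> m \<le> u \<and> u \<le> m + 1" if "t \<in> S" for t
    using that unfolding S_def closed_segment_of_real by (auto simp: closed_segment_eq_real_ivl)
  have mS: "of_real m \<in> S" "of_real (m + 1) \<in> S" by (auto simp: S_def)
  have cS: "convex S" by (auto simp: S_def)
  have nonpos: "t \<notin> \<real>\<^sub>\<le>\<^sub>0" if "t \<in> S" for t
    using S[OF that] m by (auto simp: complex_nonpos_Reals_iff)
  have powr_diff: "norm (of_real m powr (-z) - t powr (-z)) \<le> norm z * m powr (- Re z - 1)" if t: "t \<in> S" for t
  proof -
    have "norm (t powr (-z) - of_real m powr (-z)) \<le> norm z * m powr (- Re z - 1) * norm (t - of_real m)"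
    proof (rule field_differentiable_bound[OF cS _ _ t mS(1), where f' = "\<lambda>t. -z * t powr (-z - 1)"])
      fix w assume w: "w \<in> S"
      show "((\<lambda>a. a powr - z) has_field_derivative - z * w powr (- z - 1)) (at w within S)"
        using nonpos[OF w] by (auto intro!: derivative_eq_intros)
      obtain u where u: "w = of_real u" "m \<le> u" "u \<le> m + 1" using S[OF w] by blast
      have "norm (w powr (-z - 1)) = u powr (- Re z - 1)"
        unfolding u(1) using u m by (subst norm_powr_real_powr) auto
      also have "\<dots> \<le> m powr (- Re z - 1)"
        using u m z by (intro powr_mono2') auto
      finally show "norm (- z * w powr (- z - 1)) \<le> norm z * m powr (- Re z - 1)"
        by (simp add: norm_mult mult_left_mono)
    qed
    also have "\<dots> \<le> norm z * m powr (- Re z - 1) * 1"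
    proof (rule mult_left_mono)
      obtain u where u: "t = of_real u" "m \<le> u" "u \<le> m + 1" using S[OF t] by blast
      have "norm (t - of_real m) = \<bar>u - m\<bar>" unfolding u(1) of_real_diff[symmetric] by (rule norm_of_real)
      thus "norm (t - of_real m) \<le> 1" using u by simp
    qed auto
    finally show ?thesis by (simp add: norm_minus_commute)
  qed
  define h where "h = (\<lambda>t. of_real m powr (-z) * t - t powr (1 - z) / (1 - z))"
  have "norm (h (of_real (m + 1)) - h (of_real m)) \<le> norm z * m powr (- Re z - 1) * norm (complex_of_real (m + 1) - of_real m)"
  proof (rule field_differentiable_bound[OF cS _ powr_diff mS(2) mS(1)])
    fix w assume w: "w \<in> S"
    show "(h has_field_derivative of_real m powr (-z) - w powr (-z)) (at w within S)"
      unfolding h_def using nonpos[OF w] z by (auto intro!: derivative_eq_intros)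
  qed
  also have "h (of_real (m + 1)) - h (of_real m) = of_real m powr (-z)
      - (of_real (m + 1) powr (1 - z) - of_real m powr (1 - z)) / (1 - z)"
    by (simp add: h_def algebra_simps diff_divide_distrib)
  also have "\<dots> = zeta_summand n z"
    by (simp add: zeta_summand_def m_def powr_minus divide_inverse add_ac)
  finally show ?thesis by (simp add: m_def)
qed

lemma summable_Suc_powr: "s > 1 \<Longrightarrow> summable (\<lambda>n. real (Suc n) powr (- s))"
  using summable_Suc_iff[of "\<lambda>n. real n powr (- s)"] summable_real_powr_iff[of "-s"] by simp

lemma summable_zeta_summand:
  assumes z: "Re z > 0" "z \<noteq> 1"
  shows "summable (\<lambda>n. zeta_summand n z)"
proof (rule summable_comparison_test')
  show "summable (\<lambda>n. norm z * real (Suc n) powr (- Re z - 1))"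
    using summable_Suc_powr[of "Re z + 1"] z by (intro summable_mult) simp
qed (use norm_zeta_summand_le[OF z] in auto)

text \<open>The series of holomorphic summands has a summable majorant near every point, so its sum
  is differentiable.\<close>

lemma holomorphic_zeta_continuation:
  "zeta_continuation holomorphic_on ({z. 0 < Re z} - {1})"
proof -
  define S where "S = {z. 0 < Re z} - {1::complex}"
  have S: "open S" unfolding S_def by (intro open_Diff open_halfspace_Re_gt) auto
  have diff: "zeta_summand n field_differentiable (at x)" if "x \<in> S" for n x
  proof -
    have "zeta_summand n holomorphic_on S"
      unfolding zeta_summand_def by (intro holomorphic_intros) (auto simp: S_def of_nat_Suc simp del: of_nat_Suc)
    thus ?thesis using S that holomorphic_on_imp_differentiable_at by blast
  qed
  obtain g where g: "\<forall>x \<in> S. ((\<lambda>n. zeta_summand n x) sums g x) \<and> g field_differentiable (at x)"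
  proof (rule series_differentiable_comparison_complex[OF S diff])
    fix x assume x: "x \<in> S"
    \<comment> \<open>With this radius every y in the ball has Re y > d, so n^(-(d + 1)), which is
      summable, dominates uniformly.\<close>
    define d where "d = Re x / 2"
    have d: "d > 0" using x by (auto simp: d_def S_def)
    define h where "h = (\<lambda>n. complex_of_real ((norm x + d) * real (Suc n) powr (- (d + 1))))"
    have "summable (\<lambda>n. (norm x + d) * real (Suc n) powr (- (d + 1)))"
      using d by (intro summable_mult summable_Suc_powr) auto
    hence sm: "summable h" unfolding h_def by (subst summable_of_real_iff)
    have bd: "cmod (zeta_summand n y) \<le> cmod (h n)" if "y \<in> ball x d \<inter> S" for n y
    proof -
      have "\<bar>Re (x - y)\<bar> \<le> norm (x - y)" by (rule abs_Re_le_cmod)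
      also have "\<dots> < d" using that by (auto simp: dist_norm)
      finally have "\<bar>Re x - Re y\<bar> < d" by simp
      hence rey: "Re y > d" unfolding d_def by linarith
      have ny: "norm y \<le> norm x + d"
        using that norm_triangle_ineq2[of y x] by (auto simp: dist_norm norm_minus_commute)
      have "cmod (zeta_summand n y) \<le> norm y * real (Suc n) powr (- Re y - 1)"
        using that by (intro norm_zeta_summand_le) (auto simp: S_def)
      also have "\<dots> \<le> (norm x + d) * real (Suc n) powr (- (d + 1))"
        using ny rey d by (intro mult_mono powr_mono) auto
      also have "\<dots> = cmod (h n)" unfolding h_def norm_of_real using d by simp
      finally show ?thesis .
    qed
    have "range h \<subseteq> \<real>\<^sub>\<ge>\<^sub>0" using d by (auto simp: h_def simp del: of_real_mult)
    thus "\<exists>d h. 0 < d \<and> summable h \<and> range h \<subseteq> \<real>\<^sub>\<ge>\<^sub>0 \<and>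
        (\<forall>\<^sub>F n in sequentially. \<forall>y\<in>ball x d \<inter> S. cmod (zeta_summand n y) \<le> cmod (h n))"
      using d sm bd by (intro exI[of _ d] exI[of _ h]) auto
  qed
  have "g holomorphic_on S"
    using g by (auto simp: holomorphic_on_def intro: field_differentiable_at_within)
  hence "(\<lambda>z. 1 / (z - 1) + g z) holomorphic_on S"
    by (intro holomorphic_intros) (auto simp: S_def)
  also have "?this \<longleftrightarrow> zeta_continuation holomorphic_on S"
    using g by (intro holomorphic_cong) (auto simp: zeta_continuation_def sums_iff)
  finally show ?thesis by (simp add: S_def)
qed

lemma sum_zeta_summand:
  assumes "z \<noteq> 1"
  shows "(\<Sum>n<N. zeta_summand n z)
    = (\<Sum>n<N. 1 / of_nat (Suc n) powr z) - (of_nat (Suc N) powr (1 - z) - 1) / (1 - z)"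
  by (induction N) (auto simp: zeta_summand_def diff_divide_distrib)

text \<open>The integrals in the summands telescope, and the boundary term (N + 1)^(1 - z) vanishes
  in the limit when Re z > 1.\<close>

lemma zeta_continuation_eq_suminf:
  assumes z: "Re z > 1"
  shows "zeta_continuation z = (\<Sum>n. 1 / of_nat (Suc n) powr z)"
proof -
  have z': "Re z > 0" "z \<noteq> 1" using z by auto
  have "(\<lambda>N. of_nat (Suc N) powr (1 - z) :: complex) \<longlonglongrightarrow> 0"
  proof (rule tendsto_norm_zero_cancel)
    have "((\<lambda>N. real (Suc N) powr (1 - Re z)) \<longlongrightarrow> 0) sequentially"
      using z by (intro tendsto_neg_powr filterlim_compose[OF filterlim_real_sequentially] filterlim_Suc) auto
    moreover have "norm (of_nat (Suc N) powr (1 - z) :: complex) = real (Suc N) powr (1 - Re z)" for N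
      by (subst norm_powr_real_powr) (auto simp: complex_is_Real_iff)
    ultimately show "((\<lambda>N. norm (of_nat (Suc N) powr (1 - z) :: complex)) \<longlongrightarrow> 0) sequentially" by simp
  qed
  hence "(\<lambda>N. (\<Sum>n<N. zeta_summand n z) + (of_nat (Suc N) powr (1 - z) - 1) / (1 - z))
      \<longlonglongrightarrow> (\<Sum>n. zeta_summand n z) + (0 - 1) / (1 - z)"
    using z' by (intro tendsto_intros summable_LIMSEQ summable_zeta_summand) auto
  hence "(\<lambda>N. \<Sum>n<N. 1 / of_nat (Suc n) powr z) \<longlonglongrightarrow> (\<Sum>n. zeta_summand n z) + (0 - 1) / (1 - z)"
    using z' by (simp add: sum_zeta_summand)
  hence "(\<lambda>n. 1 / of_nat (Suc n) powr z) sums ((\<Sum>n. zeta_summand n z) + (0 - 1) / (1 - z))"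
    by (simp add: sums_def)
  moreover have "(0 - 1) / (1 - z) = 1 / (z - 1)"
    using z' by (simp add: field_simps)
  ultimately show ?thesis by (simp add: zeta_continuation_def sums_iff add_ac)
qed

lemma riemann_zeta_eq:
  assumes s: "Re s > 0" "s \<noteq> 1"
  shows "riemann_zeta s = zeta_continuation s"
  unfolding riemann_zeta_def
proof (rule the_equality)
  show "\<exists>c f. c < Re s \<and> f holomorphic_on ({z. c < Re z} - {1}) \<and>
     (\<forall>z. 1 < Re z \<longrightarrow> f z = (\<Sum>n. 1 / of_nat (Suc n) powr z)) \<and> f s = zeta_continuation s"
    using s holomorphic_zeta_continuation zeta_continuation_eq_suminf
    by (intro exI[of _ 0] exI[of _ zeta_continuation]) auto
next
  fix w assume "\<exists>c f. c < Re s \<and> f holomorphic_on ({z. c < Re z} - {1}) \<and>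
     (\<forall>z. 1 < Re z \<longrightarrow> f z = (\<Sum>n. 1 / of_nat (Suc n) powr z)) \<and> f s = w"
  then obtain c f where c: "c < Re s" and f: "f holomorphic_on ({z. c < Re z} - {1})"
    and eq: "\<And>z. 1 < Re z \<Longrightarrow> f z = (\<Sum>n. 1 / of_nat (Suc n) powr z)" and w: "f s = w" by blast
  \<comment> \<open>\<open>T\<close> is a region where both the candidate \<open>f\<close> and
    \<open>zeta_continuation\<close> are holomorphic; it is connected, since deleting a point does
    not disconnect an open convex set of the plane. They agree on the half-plane \<open>U\<close>,
    where both equal the Dirichlet series, hence also at \<open>s\<close>.\<close>
  define T where "T = {z. max c 0 < Re z} - {1::complex}"
  define U where "U = {z. max (max c 0) 1 < Re z}"
  have "f s = zeta_continuation s"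
  proof (rule analytic_continuation_open[where s = U and s' = T and f = f and g = zeta_continuation and z = s])
    show "open U" unfolding U_def by (rule open_halfspace_Re_gt)
    show "open T" unfolding T_def by (intro open_Diff open_halfspace_Re_gt) auto
    have "of_real (max (max c 0) 1 + 1) \<in> U" unfolding U_def mem_Collect_eq Re_complex_of_real by linarith
    thus "U \<noteq> {}" by blast
    show "connected T" unfolding T_def
      by (intro connected_open_delete convex_connected convex_halfspace_Re_gt open_halfspace_Re_gt) auto
    show "f holomorphic_on T" by (rule holomorphic_on_subset[OF f]) (auto simp: T_def)
    show "zeta_continuation holomorphic_on T"
      by (rule holomorphic_on_subset[OF holomorphic_zeta_continuation]) (auto simp: T_def)
    show "f z = zeta_continuation z" if "z \<in> U" for z
      using that by (simp add: eq zeta_continuation_eq_suminf U_def)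
  qed (use s c in \<open>auto simp: U_def T_def\<close>)
  thus "w = zeta_continuation s" using w by simp
qed

section \<open>Partial sums of real powers\<close>

lemma powr_diff_bounds:
  fixes s a b :: real
  assumes "0 < a" "a \<le> b" "s > 0" "s \<noteq> 1"
  shows "(b - a) * b powr (-s) \<le> b powr (1 - s) / (1 - s) - a powr (1 - s) / (1 - s)"
    "b powr (1 - s) / (1 - s) - a powr (1 - s) / (1 - s) \<le> (b - a) * a powr (-s)"
proof -
  have "(b - a) * b powr (-s) \<le> b powr (1 - s) / (1 - s) - a powr (1 - s) / (1 - s) \<and>
    b powr (1 - s) / (1 - s) - a powr (1 - s) / (1 - s) \<le> (b - a) * a powr (-s)"
  proof (cases "a = b")
    case False
    hence ab: "a < b" using assms by simp
    have "\<exists>\<xi>. \<xi> > a \<and> \<xi> < b \<and> b powr (1 - s) / (1 - s) - a powr (1 - s) / (1 - s) = (b - a) * \<xi> powr (-s)"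
      using assms by (intro MVT2[OF ab]) (auto intro!: derivative_eq_intros)
    then obtain \<xi> where \<xi>: "\<xi> > a" "\<xi> < b"
      "b powr (1 - s) / (1 - s) - a powr (1 - s) / (1 - s) = (b - a) * \<xi> powr (-s)" by blast
    have "b powr (-s) \<le> \<xi> powr (-s)" "\<xi> powr (-s) \<le> a powr (-s)"
      using \<xi> assms by (auto intro!: powr_mono2')
    thus ?thesis unfolding \<xi>(3) using ab by (auto intro: mult_left_mono)
  qed simp
  thus "(b - a) * b powr (-s) \<le> b powr (1 - s) / (1 - s) - a powr (1 - s) / (1 - s)"
    "b powr (1 - s) / (1 - s) - a powr (1 - s) / (1 - s) \<le> (b - a) * a powr (-s)" by auto
qed

text \<open>The counting estimates are carried out over the reals;
  \<open>riemann_zeta_of_real\<close> shows that taking the real part loses nothing at the arguments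
  in question.\<close>

definition zeta_real :: "real \<Rightarrow> real" where
  "zeta_real s = Re (riemann_zeta (of_real s))"

text \<open>Partial sum minus antiderivative of t^(-s) at N. Subtracting the antiderivative rather
  than the integral from 1 makes the limit zeta(s) itself, also for 0 < s < 1, where the partial
  sums diverge.\<close>

definition zeta_defect :: "real \<Rightarrow> nat \<Rightarrow> real" where
  "zeta_defect s N = (\<Sum>n=1..N. real n powr (-s)) - real N powr (1 - s) / (1 - s)"

text \<open>The N-th partial sum of the continued series, together with 1 / (s - 1), is the defect
  at N + 1 except for the last term (N + 1)^(-s), which tends to 0.\<close>

lemma zeta_defect_LIMSEQ:
  assumes s: "s > 0" "s \<noteq> 1"
  shows "(\<lambda>N. of_real (zeta_defect s N)) \<longlonglongrightarrow> riemann_zeta (of_real s)"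
proof -
  let ?z = "complex_of_real s"
  have z: "Re ?z > 0" "?z \<noteq> 1" using s by auto
  have "(\<lambda>N. real (Suc N) powr (- s)) \<longlonglongrightarrow> 0"
    using s by (intro tendsto_neg_powr filterlim_compose[OF filterlim_real_sequentially] filterlim_Suc) auto
  hence "(\<lambda>N. complex_of_real (real (Suc N) powr (- s))) \<longlonglongrightarrow> 0"
    using tendsto_of_real[of _ 0] by (metis of_real_0)
  hence "(\<lambda>N. 1 / (?z - 1) + (\<Sum>n<N. zeta_summand n ?z) + of_real (real (Suc N) powr (- s)))
     \<longlonglongrightarrow> 1 / (?z - 1) + (\<Sum>n. zeta_summand n ?z) + 0"
    using z by (intro tendsto_add tendsto_const summable_LIMSEQ summable_zeta_summand) auto
  moreover have "1 / (?z - 1) + (\<Sum>n<N. zeta_summand n ?z) + of_real (real (Suc N) powr (- s)) = of_real (zeta_defect s (Suc N))" for N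
  proof -
    have powr: "of_nat (Suc n) powr of_real r = complex_of_real (real (Suc n) powr r)" for n r
      using powr_of_real[of "real (Suc n)" r] by simp
    have "(\<Sum>n<N. zeta_summand n ?z) = of_real ((\<Sum>n<N. real (Suc n) powr (-s)) - (real (Suc N) powr (1 - s) - 1) / (1 - s))"
    proof -
      have "1 - ?z = of_real (1 - s)" by simp
      thus ?thesis
        unfolding sum_zeta_summand[OF z(2)] by (simp only: powr) (simp add: powr_minus field_simps)
    qed
    also have "(\<Sum>n<N. real (Suc n) powr (-s)) = (\<Sum>n=1..N. real n powr (-s))"
      by (rule sum.reindex_bij_witness[of _ "\<lambda>n. n - 1" Suc]) auto
    finally have "(\<Sum>n<N. zeta_summand n ?z) = of_real ((\<Sum>n=1..N. real n powr (-s)) - (real (Suc N) powr (1 - s) - 1) / (1 - s))" .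
    moreover have "1 / (?z - 1) = of_real (1 / (s - 1))" by simp
    ultimately have "1 / (?z - 1) + (\<Sum>n<N. zeta_summand n ?z) + of_real (real (Suc N) powr (- s)) = 
      of_real (1 / (s - 1) + ((\<Sum>n=1..N. real n powr (-s)) - (real (Suc N) powr (1 - s) - 1) / (1 - s)) + real (Suc N) powr (- s))"
      by (simp only: of_real_add)
    also have "(1 / (s - 1) + ((\<Sum>n=1..N. real n powr (-s)) - (real (Suc N) powr (1 - s) - 1) / (1 - s)) + real (Suc N) powr (- s))
       = zeta_defect s (Suc N)"
    proof -
      have "1 / (s - 1) + 1 / (1 - s) = 0" using s by (simp add: field_simps)
      thus ?thesis unfolding zeta_defect_def by (simp add: diff_divide_distrib)
    qed
    finally show ?thesis .
  qed
  ultimately have "(\<lambda>N. of_real (zeta_defect s (Suc N))) \<longlonglongrightarrow> riemann_zeta ?z"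
    by (simp add: riemann_zeta_eq[OF z] zeta_continuation_def)
  thus ?thesis using filterlim_sequentially_Suc[of "\<lambda>N. complex_of_real (zeta_defect s N)"] by simp
qed

lemma riemann_zeta_of_real:
  assumes s: "s > 0" "s \<noteq> 1"
  shows "riemann_zeta (of_real s) = of_real (zeta_real s)"
proof -
  have "(\<lambda>N. Im (of_real (zeta_defect s N))) \<longlonglongrightarrow> Im (riemann_zeta (of_real s))"
    by (intro tendsto_Im zeta_defect_LIMSEQ s)
  hence "Im (riemann_zeta (of_real s)) = 0" by (simp add: LIMSEQ_const_iff)
  thus ?thesis by (simp add: zeta_real_def complex_eq_iff)
qed

text \<open>The defect decreases in \<open>N\<close>, whereas the defect minus \<open>N powr (-s)\<close> increases; both tend to \<open>\<zeta>(s)\<close>.\<close>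
lemma zeta_defect_bounds:
  assumes s: "s > 0" "s \<noteq> 1" and N: "N > 0"
  shows "zeta_real s \<le> zeta_defect s N" "zeta_defect s N - real N powr (-s) \<le> zeta_real s"
proof -
  have lim: "(\<lambda>N. zeta_defect s N) \<longlonglongrightarrow> zeta_real s"
    using tendsto_Re[OF zeta_defect_LIMSEQ[OF s]] by (simp add: zeta_real_def)
  have step_bounds: "zeta_defect s (Suc n) \<le> zeta_defect s n \<and>
    zeta_defect s n - real n powr (-s) \<le> zeta_defect s (Suc n) - real (Suc n) powr (-s)" if "n > 0" for n
    using powr_diff_bounds[of "real n" "real (Suc n)" s] that s
    by (auto simp: zeta_defect_def)
  have mono: "zeta_defect s M \<le> zeta_defect s N \<and>
    zeta_defect s N - real N powr (-s) \<le> zeta_defect s M - real M powr (-s)" if "N \<le> M" for M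
    using that
  proof (induction M rule: dec_induct)
    case (step n) thus ?case using N step_bounds[of n] by linarith
  qed simp
  show "zeta_real s \<le> zeta_defect s N"
    using mono by (intro LIMSEQ_le_const2[OF lim]) auto
  have lim0: "(\<lambda>N. real N powr (-s)) \<longlonglongrightarrow> 0"
    using s by (intro tendsto_neg_powr filterlim_real_sequentially) auto
  have "zeta_defect s N - real N powr (-s) \<le> zeta_real s - 0"
    using mono by (intro LIMSEQ_le_const[OF tendsto_diff[OF lim lim0]]) auto
  thus "zeta_defect s N - real N powr (-s) \<le> zeta_real s" by simp
qed

text \<open>The lower defect bound at N = 1 reads 1 / (s - 1) <= zeta(s). It guarantees that the
  denominators zeta(2) and zeta(3) do not vanish.\<close>

lemma zeta_real_pos:
  assumes "s > 1"
  shows "zeta_real s > 0"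
proof -
  have "zeta_defect s 1 - real 1 powr (-s) \<le> zeta_real s"
    using assms by (intro zeta_defect_bounds) auto
  moreover have "zeta_defect s 1 = 1 - 1 / (1 - s)" by (simp add: zeta_defect_def)
  moreover have "1 / (1 - s) < 0" using assms by (intro divide_pos_neg) auto
  moreover have "real 1 powr (-s) = 1" by simp
  ultimately show ?thesis by linarith
qed

text \<open>At integers this is \<open>zeta_defect_bounds\<close>; passing from N = floor(y) to y
  moves the antiderivative by at most N^(-s).\<close>

lemma sum_powr_asymp:
  assumes s: "s > 0" "s \<noteq> 1" and y: "y \<ge> 1"
  shows "\<bar>(\<Sum>n=1..nat \<lfloor>y\<rfloor>. real n powr (-s)) - y powr (1 - s) / (1 - s) - zeta_real s\<bar>
     \<le> 2 powr (1 + s) * y powr (-s)"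
proof -
  define N where "N = nat \<lfloor>y\<rfloor>"
  have N: "N > 0" "real N \<le> y" "y \<le> real N + 1"
    using y unfolding N_def by linarith+
  \<comment> \<open>This trades N^(-s) for y^(-s) at the cost of a factor 2^s, whence the constant
    2^(1 + s).\<close>
  have N': "y / 2 \<le> real N" using N by linarith
  have "0 \<le> (y - real N) * y powr (-s)" using N by simp
  hence b: "y powr (1 - s) / (1 - s) - real N powr (1 - s) / (1 - s) \<le> (y - N) * N powr (-s)"
    "0 \<le> y powr (1 - s) / (1 - s) - real N powr (1 - s) / (1 - s)"
    using powr_diff_bounds[of "real N" y s] N s
    by linarith+
  have "(y - N) * N powr (-s) \<le> 1 * N powr (-s)"
    using N by (intro mult_right_mono) auto
  hence "\<bar>(\<Sum>n=1..N. real n powr (-s)) - y powr (1 - s) / (1 - s) - zeta_real s\<bar> \<le> 2 * N powr (-s)"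
    using b zeta_defect_bounds[OF s N(1)] unfolding zeta_defect_def by (simp add: abs_le_iff)
  also have "\<dots> \<le> 2 * (y / 2) powr (-s)"
    using N' y s by (intro mult_left_mono powr_mono2') auto
  also have "\<dots> = 2 powr (1 + s) * y powr (-s)"
    using y by (simp add: powr_divide powr_add powr_minus field_simps)
  finally show ?thesis by (simp add: N_def)
qed

section \<open>Numbers with restricted prime exponents\<close>

text \<open>The \<open>k\<close>-full numbers are \<open>exponents_in {k..}\<close>.\<close>
definition exponents_in :: "nat set \<Rightarrow> nat set" where
  "exponents_in E = {n. n > 0 \<and> (\<forall>p. prime p \<longrightarrow> multiplicity p n \<in> insert 0 E)}"

lemma exponents_in_pos: "n \<in> exponents_in E \<Longrightarrow> n > 0"
  by (simp add: exponents_in_def)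

lemma multiplicity_exponents_in: "n \<in> exponents_in E \<Longrightarrow> prime p \<Longrightarrow> multiplicity p n \<in> insert 0 E"
  by (simp add: exponents_in_def)

lemma exponents_in_mono: "E \<subseteq> F \<Longrightarrow> exponents_in E \<subseteq> exponents_in F"
  by (auto simp: exponents_in_def)

lemma finite_nat_le_real: "finite {n \<in> A. real n \<le> x}"
proof (rule finite_subset)
  show "{n \<in> A. real n \<le> x} \<subseteq> {..nat \<lfloor>x\<rfloor>}" by (auto simp: le_nat_iff le_floor_iff)
qed auto

lemma multiplicity_mult_power:
  assumes "prime p" "r > 0" "a > (0::nat)"
  shows "multiplicity p (r * a ^ k) = multiplicity p r + k * multiplicity p a"
  using assms by (simp add: prime_elem_multiplicity_mult_distrib prime_elem_multiplicity_power_distrib)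

text \<open>The exponents allowed in r, namely 0 and those strictly between k and 2k, form a
  complete residue system modulo k. So each exponent of n determines that of r by its residue, and a
  collects the multiples of k.\<close>

lemma bij_betw_mult_power_full:
  assumes k: "k > 0"
  shows "bij_betw (\<lambda>(r, a). r * a ^ k) (exponents_in {k<..<2*k} \<times> {0<..}) (exponents_in {k..})"
  unfolding bij_betw_def
proof
  show "inj_on (\<lambda>(r, a). r * a ^ k) (exponents_in {k<..<2*k} \<times> {0<..})"
  proof (rule inj_onI, clarsimp)
    fix r a r' a' :: nat
    assume r: "r \<in> exponents_in {k<..<2*k}" "r' \<in> exponents_in {k<..<2*k}"
      and a: "0 < a" "0 < a'" and eq: "r * a ^ k = r' * a' ^ k"
    have pos: "r > 0" "r' > 0" using r exponents_in_pos by auto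
    have "r = r'"
    proof (rule multiplicity_eq_nat)
      fix p :: nat assume p: "prime p"
      define i j where "i = multiplicity p r" and "j = multiplicity p r'"
      have ij: "i \<in> insert 0 {k<..<2*k}" "j \<in> insert 0 {k<..<2*k}"
        using multiplicity_exponents_in[OF r(1) p] multiplicity_exponents_in[OF r(2) p] unfolding i_def j_def by auto
      have "i + k * multiplicity p a = j + k * multiplicity p a'"
        using arg_cong[OF eq, of "multiplicity p"] p pos a by (simp add: multiplicity_mult_power i_def j_def)
      hence mod: "i mod k = j mod k" by (metis mod_mult_self2)
      have *: "i' mod k = (if i' = 0 then 0 else i' - k)" if "i' \<in> insert 0 {k<..<2*k}" for i'
        using that by (auto simp: le_mod_geq)
      show "multiplicity p r = multiplicity p r'"
        using mod *[OF ij(1)] *[OF ij(2)] ij unfolding i_def[symmetric] j_def[symmetric]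
        by (auto split: if_splits)
    qed (use pos in auto)
    moreover from this have "a ^ k = a' ^ k" using eq pos by simp
    hence "a = a'" using k a by (simp add: power_eq_iff_eq_base)
    ultimately show "r = r' \<and> a = a'" by simp
  qed
next
  show "(\<lambda>(r, a). r * a ^ k) ` (exponents_in {k<..<2*k} \<times> {0<..}) = exponents_in {k..}"
  proof (intro equalityI subsetI)
    fix n assume "n \<in> (\<lambda>(r, a). r * a ^ k) ` (exponents_in {k<..<2*k} \<times> {0<..})"
    then obtain r a where n: "n = r * a ^ k" "r \<in> exponents_in {k<..<2*k}" "a > 0" by auto
    have r: "r > 0" using n exponents_in_pos by auto
    have "multiplicity p n \<in> insert 0 {k..}" if p: "prime p" for p
    proof (cases "k \<le> multiplicity p n")
      case False
      hence "multiplicity p r + k * multiplicity p a < k"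
        using p n r by (simp add: multiplicity_mult_power)
      moreover have "multiplicity p r = 0 \<or> multiplicity p r > k"
        using multiplicity_exponents_in[OF n(2) p] by auto
      ultimately have "multiplicity p r = 0 \<and> multiplicity p a = 0"
        by (cases "multiplicity p a") auto
      thus ?thesis using p n r by (simp add: multiplicity_mult_power)
    qed auto
    thus "n \<in> exponents_in {k..}" using n r by (auto simp: exponents_in_def)
  next
    fix n assume n: "n \<in> exponents_in {k..}"
    have npos: "n > 0" using n exponents_in_pos by auto
    \<comment> \<open>The exponent of p in r. A nonzero residue is raised by k to keep r in the
      prescribed class; the result does not exceed e, since an exponent e >= k has quotient at least
      1.\<close>
    define \<rho> where "\<rho> e = (if k dvd e then 0 else k + e mod k)" for e
    define r where "r = (\<Prod>p\<in>prime_factors n. p ^ \<rho> (multiplicity p n))"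
    define a where "a = (\<Prod>p\<in>prime_factors n. p ^ ((multiplicity p n - \<rho> (multiplicity p n)) div k))"
    have pos: "r > 0" "a > 0" unfolding r_def a_def by (auto intro!: prod_pos prime_gt_0_nat)
    have \<rho>: "\<rho> e + k * ((e - \<rho> e) div k) = e" if "e = 0 \<or> e \<ge> k" for e
    proof (cases "k dvd e")
      case False
      hence e: "e > 0" by (cases "e = 0") auto
      have "e div k > 0" using that e k by (simp add: div_greater_zero_iff)
      then obtain j where "e div k = Suc j" by (auto simp: gr0_conv_Suc)
      hence "e = k + e mod k + k * j" using mult_div_mod_eq[of k e] by simp
      hence j: "e - (k + e mod k) = k * j" by linarith
      have "(e - (k + e mod k)) div k = j" unfolding j using k by simp
      thus ?thesis using False \<open>e = k + e mod k + k * j\<close> by (simp add: \<rho>_def)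
    qed (auto simp: \<rho>_def)
    have mult: "multiplicity p r = \<rho> (multiplicity p n)" "multiplicity p a = (multiplicity p n - \<rho> (multiplicity p n)) div k"
      if p: "prime p" for p
    proof -
      have "\<rho> 0 = 0" by (simp add: \<rho>_def)
      moreover have "multiplicity p n = 0" if "p \<notin> prime_factors n"
        using that p by (auto simp: prime_factors_multiplicity)
      ultimately show "multiplicity p r = \<rho> (multiplicity p n)"
        "multiplicity p a = (multiplicity p n - \<rho> (multiplicity p n)) div k"
        unfolding r_def a_def using p by (subst multiplicity_prod_prime_powers; auto)+
    qed
    have "n = r * a ^ k"
    proof (rule multiplicity_eq_nat)
      fix p :: nat assume p: "prime p"
      have "multiplicity p n = 0 \<or> multiplicity p n \<ge> k" using multiplicity_exponents_in[OF n p] by auto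
      from \<rho>[OF this] show "multiplicity p n = multiplicity p (r * a ^ k)"
        using p pos by (simp add: multiplicity_mult_power mult)
    qed (use npos pos in auto)
    moreover have "r \<in> exponents_in {k<..<2*k}"
      using pos mult k by (auto simp: exponents_in_def \<rho>_def dvd_eq_mod_eq_0)
    ultimately show "n \<in> (\<lambda>(r, a). r * a ^ k) ` (exponents_in {k<..<2*k} \<times> {0<..})"
      using pos by (intro image_eqI[of _ _ "(r, a)"]) auto
  qed
qed

section \<open>Counting k-full numbers\<close>

lemma le_powr_inverse_iff:
  fixes y :: real
  assumes "y \<ge> 0" "k > 0"
  shows "real a \<le> y powr (1 / real k) \<longleftrightarrow> real a ^ k \<le> y"
proof -
  have "(y powr (1 / real k)) ^ k = y"
    using assms by (cases "y = 0") (auto simp: powr_power)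
  thus ?thesis using assms power_mono_iff[of "real a" "y powr (1 / real k)" k] by simp
qed

lemma mult_power_le_eq:
  assumes "x \<ge> 0" "k > 0" "r > 0"
  shows "{a. a > 0 \<and> real (r * a ^ k) \<le> x} = {1..nat \<lfloor>(x / real r) powr (1 / real k)\<rfloor>}"
proof -
  have "real (r * a ^ k) \<le> x \<longleftrightarrow> a \<le> nat \<lfloor>(x / real r) powr (1 / real k)\<rfloor>" for a
  proof -
    have "real (r * a ^ k) \<le> x \<longleftrightarrow> real a ^ k \<le> x / real r"
      using assms by (simp add: pos_le_divide_eq mult.commute)
    also have "\<dots> \<longleftrightarrow> real a \<le> (x / real r) powr (1 / real k)"
      using assms by (intro le_powr_inverse_iff[symmetric]) auto
    also have "\<dots> \<longleftrightarrow> a \<le> nat \<lfloor>(x / real r) powr (1 / real k)\<rfloor>"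
      by (simp add: le_nat_iff le_floor_iff)
    finally show ?thesis .
  qed
  thus ?thesis by (intro set_eqI) (simp only: mem_Collect_eq atLeastAtMost_iff One_nat_def Suc_le_eq)
qed

text \<open>The k-full numbers are sorted by their factor r. As a >= 1, every r that occurs is at
  most x.\<close>

lemma card_full_eq_sum:
  assumes k: "k > 0" and x: "x \<ge> 0"
  shows "real (card {n \<in> exponents_in {k..}. real n \<le> x})
    = (\<Sum>r | r \<in> exponents_in {k<..<2*k} \<and> real r \<le> x. real (nat \<lfloor>(x / real r) powr (1 / real k)\<rfloor>))"
proof -
  define S where "S = Sigma {r \<in> exponents_in {k<..<2*k}. real r \<le> x} (\<lambda>r. {a. a > 0 \<and> real (r * a ^ k) \<le> x})"
  have "{n \<in> exponents_in {k..}. real n \<le> x} = (\<lambda>(r, a). r * a ^ k) ` S"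
  proof -
    have "real r \<le> x" if "real (r * a ^ k) \<le> x" "a > 0" for r a
    proof -
      have "r * 1 \<le> r * a ^ k" using that(2) by (intro mult_left_mono) auto
      hence "real r \<le> real (r * a ^ k)" by (simp only: of_nat_le_iff mult_1_right)
      thus ?thesis using that(1) by (rule order_trans)
    qed
    thus ?thesis
      unfolding bij_betw_imp_surj_on[OF bij_betw_mult_power_full[OF k], symmetric]
      by (auto simp: S_def simp del: of_nat_mult of_nat_power)
  qed
  moreover have "inj_on (\<lambda>(r, a). r * a ^ k) S"
    by (rule inj_on_subset[OF bij_betw_imp_inj_on[OF bij_betw_mult_power_full[OF k]]]) (auto simp: S_def)
  ultimately have "card {n \<in> exponents_in {k..}. real n \<le> x} = card S" by (simp add: card_image)
  also have "\<dots> = (\<Sum>r\<in>{r \<in> exponents_in {k<..<2*k}. real r \<le> x}. card {a. a > 0 \<and> real (r * a ^ k) \<le> x})"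
    unfolding S_def using k x exponents_in_pos
    by (intro card_SigmaI finite_nat_le_real) (auto simp del: of_nat_mult of_nat_power simp: mult_power_le_eq)
  also have "\<dots> = (\<Sum>r\<in>{r \<in> exponents_in {k<..<2*k}. real r \<le> x}. nat \<lfloor>(x / real r) powr (1 / real k)\<rfloor>)"
    using k x exponents_in_pos by (intro sum.cong refl, subst mult_power_le_eq) auto
  finally show ?thesis by simp
qed

text \<open>Adjoining a prime p to P splits each number uniquely as p^e n with e in
  \<open>insert 0 E\<close>; the summand 1 of each factor stands for e = 0, so 0 must not belong to
  E. Finiteness is carried through the induction because sums over infinite sets default to
  0.\<close>

lemma euler_product_finite:
  assumes "finite P" "\<And>p. p \<in> P \<Longrightarrow> prime p" "finite E" "0 \<notin> E"
  shows "finite {n \<in> exponents_in E. prime_factors n \<subseteq> P} \<and>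
    (\<Sum>n | n \<in> exponents_in E \<and> prime_factors n \<subseteq> P. real n powr (- s))
      = (\<Prod>p\<in>P. 1 + (\<Sum>e\<in>E. real p powr (- (real e * s))))"
  using assms(1,2)
proof (induction P rule: finite_induct)
  case empty
  have "{n \<in> exponents_in E. prime_factors n \<subseteq> {}} = {1}"
    by (auto simp: exponents_in_def prime_factorization_empty_iff)
  thus ?case by simp
next
  case (insert p P)
  define A where "A = {n \<in> exponents_in E. prime_factors n \<subseteq> P}"
  define A' where "A' = {n \<in> exponents_in E. prime_factors n \<subseteq> insert p P}"
  have p: "prime p" "p \<notin> P" using insert by auto
  have A0: "n > 0" "multiplicity p n = 0" if "n \<in> A" for n
    using that p by (auto simp: A_def exponents_in_def prime_factors_multiplicity)
  have mult: "multiplicity q (p ^ e * n) = (if q = p then e else multiplicity q n)" 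
    if "n \<in> A" "prime q" for n e q
    using A0[OF that(1)] that(2) p
    by (auto simp: prime_elem_multiplicity_mult_distrib prime_multiplicity_other
          prime_elem_multiplicity_power_distrib multiplicity_prime)
  have bij: "bij_betw (\<lambda>(e, n). p ^ e * n) (insert 0 E \<times> A) A'"
    unfolding bij_betw_def
  proof
    show "inj_on (\<lambda>(e, n). p ^ e * n) (insert 0 E \<times> A)"
    proof (rule inj_onI)
      fix u v assume "u \<in> insert 0 E \<times> A" "v \<in> insert 0 E \<times> A"
        "(case u of (e, n) \<Rightarrow> p ^ e * n) = (case v of (e, n) \<Rightarrow> p ^ e * n)"
      then obtain e n e' n' where uv: "u = (e, n)" "v = (e', n')"
        and n: "n \<in> A" "n' \<in> A" and eq: "p ^ e * n = p ^ e' * n'" by (cases u, cases v) auto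
      from arg_cong[OF eq, of "multiplicity p"] have "e = e'" using n p by (simp add: mult)
      with eq show "u = v" using p by (simp add: uv prime_gt_0_nat)
    qed
    show "(\<lambda>(e, n). p ^ e * n) ` (insert 0 E \<times> A) = A'"
    proof (intro equalityI subsetI)
      fix m assume "m \<in> (\<lambda>(e, n). p ^ e * n) ` (insert 0 E \<times> A)"
      then obtain e n where m: "m = p ^ e * n" "e \<in> insert 0 E" "n \<in> A" by (elim imageE SigmaE) simp
      have "m > 0" using m p A0 by (simp add: prime_gt_0_nat)
      moreover have "prime_factors m \<subseteq> insert p P"
      proof
        fix q assume "q \<in> prime_factors m"
        hence q: "prime q" "multiplicity q m > 0" by (auto simp: prime_factors_multiplicity)
        hence "q = p \<or> q \<in> prime_factors n" using m by (auto simp: mult prime_factors_multiplicity split: if_splits)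
        thus "q \<in> insert p P" using m by (auto simp: A_def)
      qed
      moreover have "multiplicity q m \<in> insert 0 E" if "prime q" for q
        using that m multiplicity_exponents_in[of n E q] by (auto simp: mult A_def)
      ultimately show "m \<in> A'" by (auto simp: A'_def exponents_in_def)
    next
      fix m assume m: "m \<in> A'"
      hence mpos: "m > 0" by (auto simp: A'_def exponents_in_def)
      obtain n where n: "m = p ^ multiplicity p m * n" "\<not> p dvd n"
        using multiplicity_decompose'[of m p] mpos p by (auto simp: prime_nat_iff)
      have npos: "n > 0" using n mpos by (cases "n = 0") auto
      have multn: "multiplicity q n = (if q = p then 0 else multiplicity q m)" if q: "prime q" for q
      proof (cases "q = p")
        case False
        have "multiplicity q m = multiplicity q (p ^ multiplicity p m * n)" using n(1) by simp
        also have "\<dots> = multiplicity q n" using q p npos False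
          by (subst prime_elem_multiplicity_mult_distrib) 
             (auto simp: prime_elem_multiplicity_power_distrib prime_multiplicity_other)
        finally show ?thesis using False by simp
      qed (use n in \<open>auto simp: not_dvd_imp_multiplicity_0\<close>)
      have "n \<in> A"
        using m npos multn by (auto simp: A_def A'_def exponents_in_def prime_factors_multiplicity split: if_splits)
      moreover have "multiplicity p m \<in> insert 0 E" using m p by (auto simp: A'_def exponents_in_def)
      ultimately show "m \<in> (\<lambda>(e, n). p ^ e * n) ` (insert 0 E \<times> A)"
        using n(1) by (intro image_eqI[of _ _ "(multiplicity p m, n)"]) auto
    qed
  qed
  have IH: "finite A" "(\<Sum>n\<in>A. real n powr (- s)) = (\<Prod>p\<in>P. 1 + (\<Sum>e\<in>E. real p powr (- (real e * s))))"
    using insert by (auto simp: A_def)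
  have finA': "finite A'" using bij_betw_finite[OF bij] IH assms by auto
  have "(\<Sum>n\<in>A'. real n powr (- s)) = (\<Sum>(e, n)\<in>insert 0 E \<times> A. real (p ^ e * n) powr (- s))"
    using sum.reindex_bij_betw[OF bij, of "\<lambda>n. real n powr (- s)"] by (simp add: case_prod_unfold)
  also have "\<dots> = (\<Sum>e\<in>insert 0 E. \<Sum>n\<in>A. real p powr (- (real e * s)) * real n powr (- s))"
    unfolding sum.cartesian_product
    by (intro sum.cong refl) (use p in \<open>auto simp: powr_mult powr_realpow[symmetric] powr_powr prime_gt_0_nat\<close>)
  also have "\<dots> = (\<Sum>e\<in>insert 0 E. real p powr (- (real e * s))) * (\<Sum>n\<in>A. real n powr (- s))"
    by (simp only: sum_product)
  also have "(\<Sum>e\<in>insert 0 E. real p powr (- (real e * s))) = 1 + (\<Sum>e\<in>E. real p powr (- (real e * s)))"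
    using assms p by (simp add: prime_gt_0_nat)
  finally have "(\<Sum>n\<in>A'. real n powr (- s)) = (\<Prod>p\<in>insert p P. 1 + (\<Sum>e\<in>E. real p powr (- (real e * s))))"
    using insert IH by simp
  with finA' show ?case by (simp add: A'_def)
qed

text \<open>Dropping the floors leaves x^(1/k) times the sum of r^(-1/k). That sum is bounded
  independently of x: in its Euler product every exponent of 1/p is at least (k + 1)/k = 1 + 1/k,
  hence above 1.\<close>

lemma card_full_le:
  assumes k: "k > 0"
  obtains C where "\<And>x. x \<ge> 0 \<Longrightarrow> real (card {n \<in> exponents_in {k..}. real n \<le> x}) \<le> C * x powr (1 / real k)"
proof -
  define \<sigma> where "\<sigma> = 1 / real k"
  define L where "L = (\<Sum>n. real n powr (- (1 + \<sigma>)))"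
  have \<sigma>: "\<sigma> > 0" using k by (simp add: \<sigma>_def)
  have summable: "summable (\<lambda>n. real n powr (- (1 + \<sigma>)))"
    using summable_real_powr_iff[of "- (1 + \<sigma>)"] \<sigma> by simp
  have "real (card {n \<in> exponents_in {k..}. real n \<le> x}) \<le> exp (real k * L) * x powr \<sigma>" if x: "x \<ge> 0" for x
  proof -
    let ?E = "{k<..<2*k}"
    define R where "R = {r \<in> exponents_in ?E. real r \<le> x}"
    define P where "P = {p \<in> {p. prime p}. real p \<le> x}"
    have P: "finite P" "\<And>p. p \<in> P \<Longrightarrow> prime p" unfolding P_def by (rule finite_nat_le_real) auto
    note euler = euler_product_finite[OF P, of ?E \<sigma>]
    have "(\<Sum>r\<in>R. real r powr (- \<sigma>)) \<le> (\<Sum>n | n \<in> exponents_in ?E \<and> prime_factors n \<subseteq> P. real n powr (- \<sigma>))"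
    proof (intro sum_mono2)
      show "R \<subseteq> {n \<in> exponents_in ?E. prime_factors n \<subseteq> P}"
      proof
        fix r assume r: "r \<in> R"
        have "real p \<le> x" if "p dvd r" for p
          using dvd_imp_le[OF that] r exponents_in_pos[of r] by (auto simp: R_def)
        thus "r \<in> {n \<in> exponents_in ?E. prime_factors n \<subseteq> P}"
          using r by (auto simp: R_def P_def prime_factors_dvd)
      qed
    qed (use euler in auto)
    also have "\<dots> = (\<Prod>p\<in>P. 1 + (\<Sum>e\<in>?E. real p powr (- (real e * \<sigma>))))" using euler by auto
    \<comment> \<open>By 1 + t <= exp t, the product is controlled by a sum over primes, which is
      then compared with the convergent series \<open>L\<close>.\<close>
    also have "\<dots> \<le> exp (\<Sum>p\<in>P. \<Sum>e\<in>?E. real p powr (- (real e * \<sigma>)))"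
      by (intro prod_le_exp_sum sum_nonneg) auto
    also have "(\<Sum>p\<in>P. \<Sum>e\<in>?E. real p powr (- (real e * \<sigma>))) \<le> (\<Sum>p\<in>P. real k * real p powr (- (1 + \<sigma>)))"
    proof (rule sum_mono)
      fix p assume p: "p \<in> P"
      have "(\<Sum>e\<in>?E. real p powr (- (real e * \<sigma>))) \<le> (\<Sum>e\<in>?E. real p powr (- (1 + \<sigma>)))"
      proof (intro sum_mono powr_mono)
        fix e assume "e \<in> ?E"
        hence "real (k + 1) * \<sigma> \<le> real e * \<sigma>" using \<sigma> by (intro mult_right_mono) auto
        moreover have "real (k + 1) * \<sigma> = 1 + \<sigma>" using k by (simp add: \<sigma>_def field_simps)
        ultimately show "- (real e * \<sigma>) \<le> - (1 + \<sigma>)" by linarith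
      qed (use P(2)[OF p] prime_ge_1_nat in auto)
      also have "\<dots> = real (card ?E) * real p powr (- (1 + \<sigma>))" by simp
      also have "\<dots> \<le> real k * real p powr (- (1 + \<sigma>))" by (intro mult_right_mono) auto
      finally show "(\<Sum>e\<in>?E. real p powr (- (real e * \<sigma>))) \<le> real k * real p powr (- (1 + \<sigma>))" .
    qed
    also have "\<dots> = real k * (\<Sum>p\<in>P. real p powr (- (1 + \<sigma>)))" by (simp add: sum_distrib_left)
    also have "\<dots> \<le> real k * L"
      unfolding L_def using summable P by (intro mult_left_mono sum_le_suminf) auto
    finally have sum: "(\<Sum>r\<in>R. real r powr (- \<sigma>)) \<le> exp (real k * L)" by simp
    have "real (card {n \<in> exponents_in {k..}. real n \<le> x}) = (\<Sum>r\<in>R. real (nat \<lfloor>(x / real r) powr \<sigma>\<rfloor>))"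
      using card_full_eq_sum[OF k x] by (simp add: R_def \<sigma>_def)
    also have "\<dots> \<le> (\<Sum>r\<in>R. (x / real r) powr \<sigma>)" by (intro sum_mono) simp
    also have "\<dots> = (\<Sum>r\<in>R. real r powr (- \<sigma>)) * x powr \<sigma>"
      unfolding sum_distrib_right using x by (intro sum.cong) (auto simp: powr_divide powr_minus_divide)
    also have "\<dots> \<le> exp (real k * L) * x powr \<sigma>" using sum by (intro mult_right_mono) auto
    finally show ?thesis .
  qed
  thus thesis using that unfolding \<sigma>_def by blast
qed

text \<open>Dyadic decomposition: the contributions of the blocks \<open>{2 ^ j * x<..2 ^ Suc j * x}\<close> decrease
  geometrically in \<open>j\<close>.\<close>
lemma sum_powr_tail_le:
  fixes A :: "nat set"
  assumes count: "\<And>x. x \<ge> 1 \<Longrightarrow> real (card {n \<in> A. real n \<le> x}) \<le> C * x powr \<theta>" and \<sigma>: "\<theta> < \<sigma>" "\<sigma> > 0"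
  obtains K where "\<And>x F. x \<ge> 1 \<Longrightarrow> finite F \<Longrightarrow> F \<subseteq> {n \<in> A. real n > x} \<Longrightarrow>
    (\<Sum>n\<in>F. real n powr (- \<sigma>)) \<le> K * x powr (\<theta> - \<sigma>)"
proof -
  define q where "q = (2::real) powr (\<theta> - \<sigma>)"
  have q: "0 < q" "q < 1" using \<sigma> by (auto simp: q_def powr_less_one)
  have "C \<ge> 0" using count[of 1] by simp
  \<comment> \<open>\<open>K\<close> solves C 2^theta + q K = K, which is exactly what closes the
    induction on j: the first block costs C 2^theta, and the induction hypothesis at 2x contributes
    q K. Hence the bound is uniform in j.\<close>
  define K where "K = C * 2 powr \<theta> / (1 - q)"
  have K: "C * 2 powr \<theta> + q * K = K" "K \<ge> 0" using q \<open>C \<ge> 0\<close> by (auto simp: K_def field_simps)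
  have block: "(\<Sum>n | n \<in> A \<and> x < real n \<and> real n \<le> 2 ^ j * x. real n powr (- \<sigma>)) \<le> K * x powr (\<theta> - \<sigma>)"
    if "x \<ge> 1" for j x
    using that
  proof (induction j arbitrary: x)
    case 0
    have empty: "{n. n \<in> A \<and> x < real n \<and> real n \<le> 2 ^ 0 * x} = {}" by auto
    show ?case unfolding empty using K by simp
  next
    case (Suc j)
    define B1 where "B1 = {n. n \<in> A \<and> x < real n \<and> real n \<le> 2 * x}"
    define y where "y = 2 ^ j * (2 * x)"
    define B2 where "B2 = {n. n \<in> A \<and> 2 * x < real n \<and> real n \<le> y}"
    have fin: "finite B1" "finite B2"
      by (rule finite_subset[OF _ finite_nat_le_real[of A "2 * x"]], force simp: B1_def)
         (rule finite_subset[OF _ finite_nat_le_real[of A y]], force simp: B2_def)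
    have "2 * x \<le> y" using Suc.prems by (simp add: y_def mult_le_cancel_right1)
    hence "{n. n \<in> A \<and> x < real n \<and> real n \<le> y} = B1 \<union> B2"
      using Suc.prems by (auto simp: B1_def B2_def)
    also have "y = 2 ^ Suc j * x" by (simp add: y_def)
    finally have "{n. n \<in> A \<and> x < real n \<and> real n \<le> 2 ^ Suc j * x} = B1 \<union> B2" .
    moreover have "B1 \<inter> B2 = {}" by (auto simp: B1_def B2_def)
    ultimately have "(\<Sum>n | n \<in> A \<and> x < real n \<and> real n \<le> 2 ^ Suc j * x. real n powr (- \<sigma>)) =
      (\<Sum>n\<in>B1. real n powr (- \<sigma>)) + (\<Sum>n\<in>B2. real n powr (- \<sigma>))"
      using fin by (simp add: sum.union_disjoint)
    also have "(\<Sum>n\<in>B2. real n powr (- \<sigma>)) \<le> K * (2 * x) powr (\<theta> - \<sigma>)"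
      unfolding B2_def y_def using Suc.prems by (intro Suc.IH) auto
    also have "(\<Sum>n\<in>B1. real n powr (- \<sigma>)) \<le> (\<Sum>n\<in>B1. x powr (- \<sigma>))"
      using Suc.prems \<sigma> by (intro sum_mono powr_mono2') (auto simp: B1_def)
    also have "\<dots> = real (card B1) * x powr (- \<sigma>)" by simp
    also have "\<dots> \<le> (C * (2 * x) powr \<theta>) * x powr (- \<sigma>)"
    proof (intro mult_right_mono)
      have "card B1 \<le> card {n \<in> A. real n \<le> 2 * x}"
        by (intro card_mono finite_nat_le_real) (auto simp: B1_def)
      also have "real \<dots> \<le> C * (2 * x) powr \<theta>" using Suc.prems by (intro count) auto
      finally show "real (card B1) \<le> C * (2 * x) powr \<theta>" by simp
    qed auto
    also have "(C * (2 * x) powr \<theta>) * x powr (- \<sigma>) + K * (2 * x) powr (\<theta> - \<sigma>) = (C * 2 powr \<theta> + q * K) * x powr (\<theta> - \<sigma>)"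
      using Suc.prems by (simp add: q_def powr_mult powr_diff powr_minus field_simps)
    finally show ?case using K by simp
  qed
  have "(\<Sum>n\<in>F. real n powr (- \<sigma>)) \<le> K * x powr (\<theta> - \<sigma>)"
    if x: "x \<ge> 1" and F: "finite F" "F \<subseteq> {n \<in> A. real n > x}" for x F
  proof -
    \<comment> \<open>Any j that covers \<open>F\<close> will do, and n <= j < 2^j suffices;
      inserting 0 makes \<open>Max\<close> meaningful for empty \<open>F\<close>.\<close>
    define j where "j = Max (insert 0 F)"
    have "real n \<le> 2 ^ j * x" if "n \<in> F" for n
    proof -
      have "n \<le> j" using that F by (simp add: j_def)
      also have "j < 2 ^ j" by simp
      finally have "real n \<le> 2 ^ j" by (metis of_nat_less_numeral_power_cancel_iff less_imp_le)
      also have "\<dots> \<le> 2 ^ j * x" using x by simp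
      finally show ?thesis .
    qed
    hence "(\<Sum>n\<in>F. real n powr (- \<sigma>)) \<le> (\<Sum>n | n \<in> A \<and> x < real n \<and> real n \<le> 2 ^ j * x. real n powr (- \<sigma>))"
      using F by (intro sum_mono2 finite_subset[OF _ finite_nat_le_real[of A "2 ^ j * x"]]) auto
    also have "\<dots> \<le> K * x powr (\<theta> - \<sigma>)" by (rule block[OF x])
    finally show ?thesis .
  qed
  thus thesis using that by blast
qed

section \<open>Cube-full numbers\<close>

lemma cubefull_reduced_subset: "exponents_in {4,5} \<subseteq> exponents_in {4..}"
  by (rule exponents_in_mono) auto

text \<open>The infinite product over all naturals, with factor 1 off the primes, is brought into
  the form of \<open>euler_product_finite\<close> with E = {4,5} and s = 1/3.\<close>

lemma gamma_0_3_LIMSEQ: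
  "(\<lambda>N. \<Prod>p | prime p \<and> p \<le> N. 1 + (\<Sum>e\<in>{4,5}. real p powr (- (real e * (1/3))))) \<longlonglongrightarrow> gamma_0_3"
proof -
  define f where "f = (\<lambda>p. if prime p then 1 + real p powr (- (4 / 3)) + real p powr (- (5 / 3)) else 1)"
  have "summable (\<lambda>p. real p powr (- (4 / 3)) + real p powr (- (5 / 3)))"
    by (intro summable_add) (simp_all add: summable_real_powr_iff)
  hence "summable (\<lambda>p. norm (f p - 1))"
    by (rule summable_comparison_test') (auto simp: f_def)
  hence "convergent_prod f"
    by (intro abs_convergent_prod_imp_convergent_prod) (simp add: abs_convergent_prod_conv_summable)
  hence "(\<lambda>N. \<Prod>p\<le>N. f p) \<longlonglongrightarrow> prodinf f" by (rule convergent_prod_LIMSEQ)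
  moreover have "(\<Prod>p\<le>N. f p) = (\<Prod>p | prime p \<and> p \<le> N. 1 + (\<Sum>e\<in>{4,5}. real p powr (- (real e * (1/3)))))" for N
  proof -
    have "(\<Prod>p\<le>N. f p) = (\<Prod>p | prime p \<and> p \<le> N. f p)"
      by (intro prod.mono_neutral_right) (auto simp: f_def)
    also have "\<dots> = (\<Prod>p | prime p \<and> p \<le> N. 1 + (\<Sum>e\<in>{4,5}. real p powr (- (real e * (1/3)))))"
      by (intro prod.cong) (auto simp: f_def add_ac)
    finally show ?thesis .
  qed
  ultimately show ?thesis by (simp add: gamma_0_3_def f_def)
qed

text \<open>For N >= floor(x), the Euler product over primes up to N contains every r <= x, and its
  remaining terms all have r > x. Those r are 4-full, so the tail estimate with exponents 1/4 and
  1/3 bounds them by x^(1/4 - 1/3) = x^(-1/12); then N tends to infinity.\<close>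

lemma sum_cubefull_reduced:
  obtains K where "\<And>x. x \<ge> 1 \<Longrightarrow>
    \<bar>(\<Sum>r | r \<in> exponents_in {4,5} \<and> real r \<le> x. real r powr (- (1/3))) - gamma_0_3\<bar> \<le> K * x powr (- (1/12))"
proof -
  obtain C where C: "\<And>x. x \<ge> 0 \<Longrightarrow> real (card {n \<in> exponents_in {4..}. real n \<le> x}) \<le> C * x powr (1 / real 4)"
    using card_full_le[of 4] by auto
  have count: "real (card {n \<in> exponents_in {4,5}. real n \<le> x}) \<le> C * x powr (1/4)" if "x \<ge> 1" for x
  proof -
    have "card {n \<in> exponents_in {4,5}. real n \<le> x} \<le> card {n \<in> exponents_in {4..}. real n \<le> x}"
      using cubefull_reduced_subset by (intro card_mono finite_nat_le_real) auto
    also have "real \<dots> \<le> C * x powr (1/4)" using C[of x] that by simp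
    finally show ?thesis by simp
  qed
  obtain K where K: "\<And>x F. x \<ge> 1 \<Longrightarrow> finite F \<Longrightarrow> F \<subseteq> {n \<in> exponents_in {4,5}. real n > x} \<Longrightarrow>
    (\<Sum>n\<in>F. real n powr (- (1/3))) \<le> K * x powr (1/4 - 1/3)"
    using sum_powr_tail_le[OF count, of "1/3"] by auto
  have "\<bar>(\<Sum>r | r \<in> exponents_in {4,5} \<and> real r \<le> x. real r powr (- (1/3))) - gamma_0_3\<bar> \<le> K * x powr (- (1/12))"
    if x: "x \<ge> 1" for x
  proof -
    define S where "S = (\<Sum>r | r \<in> exponents_in {4,5} \<and> real r \<le> x. real r powr (- (1/3)))"
    define Q where "Q = (\<lambda>N::nat. \<Prod>p | prime p \<and> p \<le> N. 1 + (\<Sum>e\<in>{4,5}. real p powr (- (real e * (1/3)))))"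
    have bounds: "S \<le> Q N \<and> Q N \<le> S + K * x powr (- (1/12))" if N: "N \<ge> nat \<lfloor>x\<rfloor>" for N
    proof -
      define P where "P = {p. prime p \<and> p \<le> N}"
      have P: "finite P" "\<And>p. p \<in> P \<Longrightarrow> prime p" by (auto simp: P_def)
      define A where "A = {n \<in> exponents_in {4,5}. prime_factors n \<subseteq> P}"
      have A: "finite A" "(\<Sum>n\<in>A. real n powr (- (1/3))) = Q N"
        using euler_product_finite[OF P, of "{4,5}" "1/3"] by (auto simp: A_def Q_def P_def)
      have split: "{r \<in> exponents_in {4,5}. real r \<le> x} = A \<inter> {r. real r \<le> x}"
      proof -
        have "p \<le> N" if "p dvd r" "r > 0" "real r \<le> x" for p r
        proof -
          have "p \<le> r" using that by (intro dvd_imp_le)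
          also have "r \<le> nat \<lfloor>x\<rfloor>" using that by (simp add: le_nat_iff le_floor_iff)
          finally show ?thesis using N by simp
        qed
        thus ?thesis using exponents_in_pos by (auto simp: A_def P_def prime_factors_dvd)
      qed
      have "Q N = (\<Sum>n\<in>A \<inter> {r. real r \<le> x}. real n powr (- (1/3))) + (\<Sum>n\<in>A - {r. real r \<le> x}. real n powr (- (1/3)))"
        unfolding A(2)[symmetric] using A(1) by (rule sum.Int_Diff)
      also have "(\<Sum>n\<in>A \<inter> {r. real r \<le> x}. real n powr (- (1/3))) = S" unfolding S_def split[symmetric] by simp
      finally have "Q N = S + (\<Sum>n\<in>A - {r. real r \<le> x}. real n powr (- (1/3)))" .
      moreover have "(\<Sum>n\<in>A - {r. real r \<le> x}. real n powr (- (1/3))) \<le> K * x powr (1/4 - 1/3)"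
        using A(1) by (intro K x) (auto simp: A_def)
      moreover have "(\<Sum>n\<in>A - {r. real r \<le> x}. real n powr (- (1/3))) \<ge> 0" by (intro sum_nonneg) auto
      ultimately show ?thesis by simp
    qed
    have lim: "Q \<longlonglongrightarrow> gamma_0_3" using gamma_0_3_LIMSEQ by (simp add: Q_def)
    have "S \<le> gamma_0_3" using bounds by (intro LIMSEQ_le_const[OF lim]) auto
    moreover have "gamma_0_3 \<le> S + K * x powr (- (1/12))" using bounds by (intro LIMSEQ_le_const2[OF lim]) auto
    ultimately show ?thesis by (simp add: S_def)
  qed
  thus thesis using that by blast
qed

text \<open>Two errors of the same size: removing the floors costs at most 1 for each of the
  O(x^(1/4)) values r, and completing the sum over r costs x^(1/3) x^(-1/12).\<close>

lemma card_cubefull_asymp: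
  obtains K where "\<And>x. x \<ge> 1 \<Longrightarrow>
    \<bar>real (card {n \<in> exponents_in {3..}. real n \<le> x}) - gamma_0_3 * x powr (1/3)\<bar> \<le> K * x powr (1/4)"
proof -
  obtain C where C: "\<And>x. x \<ge> 0 \<Longrightarrow> real (card {n \<in> exponents_in {4..}. real n \<le> x}) \<le> C * x powr (1 / real 4)"
    using card_full_le[of 4] by auto
  obtain K where K: "\<And>x. x \<ge> 1 \<Longrightarrow>
    \<bar>(\<Sum>r | r \<in> exponents_in {4,5} \<and> real r \<le> x. real r powr (- (1/3))) - gamma_0_3\<bar> \<le> K * x powr (- (1/12))"
    using sum_cubefull_reduced by blast
  have E: "{3<..<2*3} = {4,5::nat}" by auto
  have "\<bar>real (card {n \<in> exponents_in {3..}. real n \<le> x}) - gamma_0_3 * x powr (1/3)\<bar> \<le> (C + K) * x powr (1/4)"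
    if x: "x \<ge> 1" for x
  proof -
    define R where "R = {r. r \<in> exponents_in {4,5} \<and> real r \<le> x}"
    define S where "S = (\<Sum>r\<in>R. real r powr (- (1/3)))"
    have "real (card {n \<in> exponents_in {3..}. real n \<le> x}) = (\<Sum>r\<in>R. real (nat \<lfloor>(x / real r) powr (1/3)\<rfloor>))"
      using card_full_eq_sum[of 3 x] x unfolding E by (simp add: R_def)
    moreover have "x powr (1/3) * S = (\<Sum>r\<in>R. (x / real r) powr (1/3))"
      unfolding S_def sum_distrib_left using x
      by (intro sum.cong) (auto simp: powr_divide powr_minus_divide)
    ultimately have "\<bar>real (card {n \<in> exponents_in {3..}. real n \<le> x}) - x powr (1/3) * S\<bar>
       = \<bar>\<Sum>r\<in>R. real (nat \<lfloor>(x / real r) powr (1/3)\<rfloor>) - (x / real r) powr (1/3)\<bar>"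
      by (simp add: sum_subtractf)
    also have "\<dots> \<le> (\<Sum>r\<in>R. \<bar>real (nat \<lfloor>(x / real r) powr (1/3)\<rfloor>) - (x / real r) powr (1/3)\<bar>)" by (rule sum_abs)
    also have "\<dots> \<le> (\<Sum>r\<in>R. 1)"
    proof (rule sum_mono)
      fix r
      have "(x / real r) powr (1/3) \<ge> 0" by simp
      thus "\<bar>real (nat \<lfloor>(x / real r) powr (1/3)\<rfloor>) - (x / real r) powr (1/3)\<bar> \<le> 1" by linarith
    qed
    also have "\<dots> = real (card R)" by simp
    also have "real (card R) \<le> real (card {n \<in> exponents_in {4..}. real n \<le> x})"
      unfolding of_nat_le_iff using cubefull_reduced_subset
      by (intro card_mono finite_nat_le_real) (auto simp: R_def)
    also have "\<dots> \<le> C * x powr (1/4)" using C[of x] x by simp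
    finally have 1: "\<bar>real (card {n \<in> exponents_in {3..}. real n \<le> x}) - x powr (1/3) * S\<bar> \<le> C * x powr (1/4)" by simp
    have "x powr (1/3) * S - gamma_0_3 * x powr (1/3) = x powr (1/3) * (S - gamma_0_3)"
      by (simp add: algebra_simps)
    hence "\<bar>x powr (1/3) * S - gamma_0_3 * x powr (1/3)\<bar> = x powr (1/3) * \<bar>S - gamma_0_3\<bar>"
      by (simp add: abs_mult)
    also have "\<dots> \<le> x powr (1/3) * (K * x powr (- (1/12)))"
      using K[OF x] by (intro mult_left_mono) (auto simp: S_def R_def)
    also have "\<dots> = K * x powr (1/3 + - (1/12))" unfolding powr_add by simp
    finally have "\<bar>x powr (1/3) * S - gamma_0_3 * x powr (1/3)\<bar> \<le> K * x powr (1/4)" by simp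
    with 1 show ?thesis unfolding distrib_right by linarith
  qed
  thus thesis using that by blast
qed

section \<open>Moebius inversion\<close>

definition moebius_mu :: "nat \<Rightarrow> real" where
  "moebius_mu n = (if squarefree n then (-1) ^ card (prime_factors n) else 0)"

lemma abs_moebius_mu_le_1: "\<bar>moebius_mu n\<bar> \<le> 1"
  by (simp add: moebius_mu_def power_abs)

lemma moebius_mu_prime_mult:
  assumes "prime p" "\<not> p dvd d"
  shows "moebius_mu (p * d) = - moebius_mu d"
proof -
  have d: "d > 0" using assms by (cases "d = 0") auto
  have cop: "coprime p d" using assms by (simp add: prime_imp_coprime)
  have "squarefree (p * d) \<longleftrightarrow> squarefree d"
    using squarefree_mult_coprime[OF cop] squarefree_prime assms(1) squarefree_multD(2) by blast
  moreover have "prime_factors (p * d) = insert p (prime_factors d)"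
    using assms d by (subst prime_factors_product) (auto simp: prime_gt_0_nat prime_prime_factors)
  moreover have "p \<notin> prime_factors d" using assms by auto
  ultimately show ?thesis by (simp add: moebius_mu_def)
qed

text \<open>Fix a prime p dividing n. The squarefree divisors d prime to p cancel against their
  partners p d.\<close>

lemma sum_moebius_mu_divisors:
  assumes "n > 0"
  shows "(\<Sum>d | d dvd n. moebius_mu d) = (if n = 1 then 1 else 0)"
proof (cases "n = 1")
  case False
  then obtain p where p: "prime p" "p dvd n" using prime_factor_nat by blast
  define S where "S = {d. d dvd n \<and> squarefree d}"
  define S0 where "S0 = {d. d dvd n \<and> squarefree d \<and> \<not> p dvd d}"
  have fin: "finite S0" using assms by (auto simp: S0_def intro: finite_subset[OF _ finite_divisors_nat[of n]])
  have "(\<Sum>d | d dvd n. moebius_mu d) = (\<Sum>d\<in>S. moebius_mu d)"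
    using assms by (intro sum.mono_neutral_right) (auto simp: S_def moebius_mu_def)
  also have "S = S0 \<union> (*) p ` S0"
  proof (intro equalityI subsetI)
    fix d assume d: "d \<in> S"
    show "d \<in> S0 \<union> (*) p ` S0"
    proof (cases "p dvd d")
      case True
      then obtain e where e: "d = p * e" by blast
      have "\<not> p dvd e"
      proof
        assume "p dvd e"
        hence "p ^ 2 dvd d" using e by (auto simp: power2_eq_square)
        with d p show False by (auto simp: S_def squarefree_def prime_nat_iff)
      qed
      moreover have "squarefree e" using d e squarefree_multD(2) by (auto simp: S_def)
      moreover have "e dvd n" using d e by (auto simp: S_def dest: dvd_mult_right)
      ultimately show ?thesis using e by (auto simp: S0_def)
    qed (use d in \<open>auto simp: S_def S0_def\<close>)
  next
    fix d assume "d \<in> S0 \<union> (*) p ` S0"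
    moreover have "p * e \<in> S" if "e \<in> S0" for e
    proof -
      have "coprime p e" using that p by (simp add: S0_def prime_imp_coprime)
      thus ?thesis using that p squarefree_prime[OF p(1)]
        by (auto simp: S_def S0_def intro: divides_mult squarefree_mult_coprime)
    qed
    ultimately show "d \<in> S" by (auto simp: S_def S0_def)
  qed
  also have "(\<Sum>d\<in>S0 \<union> (*) p ` S0. moebius_mu d) = (\<Sum>d\<in>S0. moebius_mu d) + (\<Sum>d\<in>(*) p ` S0. moebius_mu d)"
    using fin by (intro sum.union_disjoint) (auto simp: S0_def)
  also have "(\<Sum>d\<in>(*) p ` S0. moebius_mu d) = (\<Sum>d\<in>S0. moebius_mu (p * d))"
    using p by (subst sum.reindex) (auto simp: inj_on_def prime_gt_0_nat)
  also have "\<dots> = (\<Sum>d\<in>S0. - moebius_mu d)"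
    using p by (intro sum.cong moebius_mu_prime_mult) (auto simp: S0_def)
  finally show ?thesis using False by (simp add: sum_negf)
qed (simp add: moebius_mu_def)

text \<open>After inserting G, each F(x / n^6) carries the sum of mu(d) over the divisors d of n, so
  only n = 1 survives. F and G are arbitrary so that the inversion can be applied to error
  terms.\<close>

lemma moebius_inversion_sixth_powers:
  fixes F G :: "real \<Rightarrow> real"
  assumes G: "\<And>y. y \<ge> 1 \<Longrightarrow> G y = (\<Sum>d | d > 0 \<and> real d ^ 6 \<le> y. F (y / real d ^ 6))" and x: "x \<ge> 1"
  shows "F x = (\<Sum>d | d > 0 \<and> real d ^ 6 \<le> x. moebius_mu d * G (x / real d ^ 6))"
proof -
  define D where "D = (\<lambda>y. {d. d > 0 \<and> real d ^ 6 \<le> y})"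
  have fin: "finite (D y)" for y
  proof (rule finite_subset[OF _ finite_nat_le_real[of UNIV y]])
    show "D y \<subseteq> {n \<in> UNIV. real n \<le> y}"
    proof
      fix d assume d: "d \<in> D y"
      have "real d \<le> real d ^ 6" by (rule self_le_power) (use d in \<open>auto simp: D_def\<close>)
      also have "\<dots> \<le> y" using d by (simp add: D_def)
      finally show "d \<in> {n \<in> UNIV. real n \<le> y}" by simp
    qed
  qed
  have D_mult: "d * e \<in> D x \<longleftrightarrow> e \<in> D (x / real d ^ 6)" if "d > 0" for d e
    using that by (simp add: D_def pos_le_divide_eq power_mult_distrib mult.commute)
  have "(\<Sum>d\<in>D x. moebius_mu d * G (x / real d ^ 6)) =
    (\<Sum>d\<in>D x. \<Sum>e\<in>D (x / real d ^ 6). moebius_mu d * F (x / real (d * e) ^ 6))"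
  proof (intro sum.cong refl)
    fix d assume d: "d \<in> D x"
    hence "x / real d ^ 6 \<ge> 1" by (simp add: D_def)
    from G[OF this] show "moebius_mu d * G (x / real d ^ 6) =
       (\<Sum>e\<in>D (x / real d ^ 6). moebius_mu d * F (x / real (d * e) ^ 6))"
      by (simp add: D_def sum_distrib_left power_mult_distrib)
  qed
  also have "\<dots> = (\<Sum>(d, e)\<in>Sigma (D x) (\<lambda>d. D (x / real d ^ 6)). moebius_mu d * F (x / real (d * e) ^ 6))"
    using fin by (simp add: sum.Sigma)
  \<comment> \<open>Reindexing by n = d e: the pair (d, e) becomes n together with its divisor
    d.\<close>
  also have "\<dots> = (\<Sum>(n, d)\<in>Sigma (D x) (\<lambda>n. {d. d dvd n}). moebius_mu d * F (x / real n ^ 6))"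
  proof (rule sum.reindex_bij_witness[of _ "\<lambda>(n, d). (d, n div d)" "\<lambda>(d, e). (d * e, d)"])
    have D_pos: "d > 0" if "d \<in> D y" for d y using that by (simp add: D_def)
    fix u assume u: "u \<in> Sigma (D x) (\<lambda>d. D (x / real d ^ 6))"
    show "(case (case u of (d, e) \<Rightarrow> (d * e, d)) of (n, d) \<Rightarrow> (d, n div d)) = u"
      using u D_pos by auto
    show "(case u of (d, e) \<Rightarrow> (d * e, d)) \<in> Sigma (D x) (\<lambda>n. {d. d dvd n})"
      using u D_pos D_mult by auto
    show "(case (case u of (d, e) \<Rightarrow> (d * e, d)) of (n, d) \<Rightarrow> moebius_mu d * F (x / real n ^ 6)) =
        (case u of (d, e) \<Rightarrow> moebius_mu d * F (x / real (d * e) ^ 6))"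
      by (simp add: case_prod_unfold)
  next
    fix v assume v: "v \<in> Sigma (D x) (\<lambda>n. {d. d dvd n})"
    then obtain n d where nd: "v = (n, d)" "n \<in> D x" "d dvd n" by (elim SigmaE) simp
    show "(case (case v of (n, d) \<Rightarrow> (d, n div d)) of (d, e) \<Rightarrow> (d * e, d)) = v"
      using nd by simp
    have "d \<in> D x" "d > 0"
    proof -
      have "d \<le> n" "d > 0" using nd by (auto simp: D_def intro: dvd_imp_le dvd_pos_nat)
      hence "real d ^ 6 \<le> real n ^ 6" by (intro power_mono) auto
      also have "\<dots> \<le> x" using nd by (simp add: D_def)
      finally show "d \<in> D x" "d > 0" using \<open>d > 0\<close> by (simp_all add: D_def)
    qed
    moreover have "d * (n div d) \<in> D x" using nd by simp
    hence "n div d \<in> D (x / real d ^ 6)" using D_mult[OF \<open>d > 0\<close>] by blast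
    ultimately show "(case v of (n, d) \<Rightarrow> (d, n div d)) \<in> Sigma (D x) (\<lambda>d. D (x / real d ^ 6))"
      using nd by simp
  qed
  also have "\<dots> = (\<Sum>n\<in>D x. \<Sum>d | d dvd n. moebius_mu d * F (x / real n ^ 6))"
    by (intro sum.Sigma[symmetric] fin) (auto simp: D_def)
  also have "\<dots> = (\<Sum>n\<in>D x. (if n = 1 then 1 else 0) * F (x / real n ^ 6))"
  proof (intro sum.cong refl)
    fix n assume "n \<in> D x"
    thus "(\<Sum>d | d dvd n. moebius_mu d * F (x / real n ^ 6)) = (if n = 1 then 1 else 0) * F (x / real n ^ 6)"
      by (subst sum_moebius_mu_divisors[symmetric]) (auto simp: D_def sum_distrib_right)
  qed
  also have "\<dots> = (\<Sum>n\<in>{1}. (if n = 1 then 1 else 0) * F (x / real n ^ 6))"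
    using fin x by (intro sum.mono_neutral_right) (auto simp: D_def)
  finally show ?thesis by (simp add: D_def)
qed

section \<open>Square-full numbers\<close>

text \<open>The count has generating Dirichlet series zeta(2s) zeta(3s). Pairs are stored as (b, a),
  with the cubed variable first.\<close>

definition lattice_points :: "real \<Rightarrow> (nat \<times> nat) set" where
  "lattice_points y = {(b, a). b > 0 \<and> a > 0 \<and> real (a ^ 2 * b ^ 3) \<le> y}"

text \<open>Each floor moves its term by at most 1; nonnegativity matters because \<open>nat\<close>
  sends negative floors to 0.\<close>

lemma abs_sum_floor_le:
  assumes "\<And>n. n \<in> A \<Longrightarrow> f n \<ge> 0"
  shows "\<bar>(\<Sum>n\<in>A. real (nat \<lfloor>f n\<rfloor>)) - (\<Sum>n\<in>A. f n)\<bar> \<le> real (card A)"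
proof -
  have "\<bar>(\<Sum>n\<in>A. real (nat \<lfloor>f n\<rfloor>)) - (\<Sum>n\<in>A. f n)\<bar> = \<bar>\<Sum>n\<in>A. real (nat \<lfloor>f n\<rfloor>) - f n\<bar>"
    by (simp only: sum_subtractf)
  also have "\<dots> \<le> (\<Sum>n\<in>A. \<bar>real (nat \<lfloor>f n\<rfloor>) - f n\<bar>)" by (rule sum_abs)
  also have "\<dots> \<le> (\<Sum>n\<in>A. 1)"
  proof (rule sum_mono)
    fix n assume "n \<in> A"
    from assms[OF this] show "\<bar>real (nat \<lfloor>f n\<rfloor>) - f n\<bar> \<le> 1" by linarith
  qed
  finally show ?thesis by simp
qed

text \<open>Dirichlet's hyperbola method, splitting at \<open>a \<le> y powr (1/5)\<close> or \<open>b \<le> y powr (1/5)\<close>;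
  the secondary main terms \<open>- 2 * B\<^sup>2 + 3 * B\<^sup>2 - B\<^sup>2\<close> cancel.\<close>
lemma card_lattice_points_decomposition:
  assumes y: "y \<ge> 1"
  defines "M \<equiv> nat \<lfloor>y powr (1/5)\<rfloor>"
  shows "real (card (lattice_points y)) = (\<Sum>b=1..M. real (nat \<lfloor>(y / real b ^ 3) powr (1/2)\<rfloor>))
    + (\<Sum>a=1..M. real (nat \<lfloor>(y / real a ^ 2) powr (1/3)\<rfloor>)) - real M ^ 2"
proof -
  define B where "B = y powr (1/5)"
  have B: "B ^ 5 = y" "B > 0" using y by (auto simp: B_def powr_power)
  have leM: "n \<le> M \<longleftrightarrow> real n \<le> B" for n
    using B by (simp add: M_def B_def le_nat_iff le_floor_iff)
  define A1 where "A1 = Sigma {1..M} (\<lambda>b. {a. a > 0 \<and> real (b ^ 3 * a ^ 2) \<le> y})"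
  define A2 where "A2 = Sigma {1..M} (\<lambda>a. {b. b > 0 \<and> real (a ^ 2 * b ^ 3) \<le> y})"
  have E1: "{a. a > 0 \<and> real (b ^ 3 * a ^ 2) \<le> y} = {1..nat \<lfloor>(y / real b ^ 3) powr (1/2)\<rfloor>}" if "b > 0" for b
    using mult_power_le_eq[of y 2 "b ^ 3"] y that by simp
  have E2: "{b. b > 0 \<and> real (a ^ 2 * b ^ 3) \<le> y} = {1..nat \<lfloor>(y / real a ^ 2) powr (1/3)\<rfloor>}" if "a > 0" for a
    using mult_power_le_eq[of y 3 "a ^ 2"] y that by simp
  have fin1: "finite {a. a > 0 \<and> real (b ^ 3 * a ^ 2) \<le> y}" if "b > 0" for b
    unfolding E1[OF that] by simp
  have fin2: "finite {b. b > 0 \<and> real (a ^ 2 * b ^ 3) \<le> y}" if "a > 0" for a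
    unfolding E2[OF that] by simp
  have fin: "finite A1" "finite A2"
    unfolding A1_def A2_def by (intro finite_SigmaI fin1 fin2; simp)+
  have "card A1 = (\<Sum>b=1..M. card {a. a > 0 \<and> real (b ^ 3 * a ^ 2) \<le> y})"
    unfolding A1_def by (intro card_SigmaI ballI fin1) auto
  also have "\<dots> = (\<Sum>b=1..M. nat \<lfloor>(y / real b ^ 3) powr (1/2)\<rfloor>)"
    by (rule sum.cong[OF refl], subst E1) auto
  finally have c1: "card A1 = (\<Sum>b=1..M. nat \<lfloor>(y / real b ^ 3) powr (1/2)\<rfloor>)" .
  have "card A2 = (\<Sum>a=1..M. card {b. b > 0 \<and> real (a ^ 2 * b ^ 3) \<le> y})"
    unfolding A2_def by (intro card_SigmaI ballI fin2) auto
  also have "\<dots> = (\<Sum>a=1..M. nat \<lfloor>(y / real a ^ 2) powr (1/3)\<rfloor>)"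
    by (rule sum.cong[OF refl], subst E2) auto
  finally have c2: "card A2 = (\<Sum>a=1..M. nat \<lfloor>(y / real a ^ 2) powr (1/3)\<rfloor>)" .
  \<comment> \<open>As B^5 = y, the whole square a, b <= M lies in the region, while no point of the
    region has both coordinates above M. So the two strips cover everything and overlap in exactly
    M^2 points.\<close>
  have in_box: "real (a ^ 2 * b ^ 3) \<le> y" if "a \<le> M" "b \<le> M" for a b
  proof -
    have "real a ^ 2 * real b ^ 3 \<le> B ^ 2 * B ^ 3"
      using that B by (intro mult_mono power_mono) (auto simp: leM)
    also have "\<dots> = y" unfolding B(1)[symmetric] by (simp flip: power_add)
    finally show ?thesis by simp
  qed
  have out_box: "a \<le> M \<or> b \<le> M" if "real (a ^ 2 * b ^ 3) \<le> y" for a b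
  proof (rule ccontr)
    assume "\<not> (a \<le> M \<or> b \<le> M)"
    hence "B ^ 2 * B ^ 3 < real a ^ 2 * real b ^ 3"
      using B by (intro mult_strict_mono power_strict_mono) (auto simp: leM)
    also have "B ^ 2 * B ^ 3 = y" unfolding B(1)[symmetric] by (simp flip: power_add)
    finally show False using that by simp
  qed
  have union: "lattice_points y = A1 \<union> prod.swap ` A2"
  proof (intro set_eqI iffI)
    fix z assume "z \<in> lattice_points y"
    then obtain a b where z: "z = (b, a)" "b > 0" "a > 0" "real (a ^ 2 * b ^ 3) \<le> y"
      unfolding lattice_points_def by blast
    from out_box[OF z(4)] show "z \<in> A1 \<union> prod.swap ` A2"
    proof
      assume "a \<le> M"
      hence "(a, b) \<in> A2" using z by (simp add: A2_def)
      thus ?thesis using z by (intro UnI2 image_eqI[of _ _ "(a, b)"]) auto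
    next
      assume "b \<le> M"
      thus ?thesis using z by (intro UnI1) (simp add: A1_def mult.commute)
    qed
  next
    fix z assume "z \<in> A1 \<union> prod.swap ` A2"
    thus "z \<in> lattice_points y" by (auto simp: A1_def A2_def lattice_points_def mult.commute)
  qed
  have inter: "A1 \<inter> prod.swap ` A2 = {1..M} \<times> {1..M}"
  proof (intro set_eqI iffI)
    fix z assume "z \<in> A1 \<inter> prod.swap ` A2"
    thus "z \<in> {1..M} \<times> {1..M}" by (auto simp: A1_def A2_def)
  next
    fix z assume z: "z \<in> {1..M} \<times> {1..M}"
    then obtain b a where ba: "z = (b, a)" "b \<in> {1..M}" "a \<in> {1..M}" by (elim SigmaE) simp
    have "real (a ^ 2 * b ^ 3) \<le> y" using ba by (intro in_box) auto
    hence "z \<in> A1" "(a, b) \<in> A2" using ba by (auto simp: A1_def A2_def mult.commute)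
    thus "z \<in> A1 \<inter> prod.swap ` A2" using ba by (intro IntI image_eqI[of _ _ "(a, b)"]) auto
  qed
  have "card (prod.swap ` A2) = card A2" by (intro card_image) auto
  moreover have "card A1 + card (prod.swap ` A2) = card (lattice_points y) + card ({1..M} \<times> {1..M})"
    unfolding union inter[symmetric] using fin by (intro card_Un_Int) auto
  ultimately have "card A1 + card A2 = card (lattice_points y) + M * M"
    by (simp add: card_cartesian_product)
  hence "real (card (lattice_points y)) = real (card A1) + real (card A2) - real M ^ 2"
    by (simp add: power2_eq_square flip: of_nat_add of_nat_mult)
  thus ?thesis unfolding c1 c2 of_nat_sum .
qed

text \<open>All quantities are expressed through B = y^(1/5), where y^(1/2) = B^(5/2) and y^(1/3) =
  B^(5/3). Multiplied by these, the errors B^(-3/2) and B^(-2/3) of the two power sums both become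
  B.\<close>

lemma card_lattice_points_asymp:
  obtains K where "\<And>y. y \<ge> 1 \<Longrightarrow> \<bar>real (card (lattice_points y))
    - zeta_real (3/2) * y powr (1/2) - zeta_real (2/3) * y powr (1/3)\<bar> \<le> K * y powr (1/5)"
proof -
  have abs_scale: "c * \<bar>t\<bar> = \<bar>c * t\<bar>" if "c \<ge> 0" for c t :: real
    using that by (simp add: abs_mult)
  \<comment> \<open>The 4 is 1 + 1 for the floors in the two sums plus 2 for replacing M^2 by B^2;
    the powers of 2 come from \<open>sum_powr_asymp\<close> at s = 3/2 and s = 2/3.\<close>
  define K where "K = 4 + 2 powr (5/2) + (2::real) powr (5/3)"
  have "\<bar>real (card (lattice_points y)) - zeta_real (3/2) * y powr (1/2) - zeta_real (2/3) * y powr (1/3)\<bar>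
      \<le> K * y powr (1/5)" if y: "y \<ge> 1" for y
  proof -
    define B where "B = y powr (1/5)"
    define M where "M = nat \<lfloor>B\<rfloor>"
    have B: "B \<ge> 1" using y by (simp add: B_def ge_one_powr_ge_zero)
    have yB: "y powr (1/2) = B powr (5/2)" "y powr (1/3) = B powr (5/3)" 
      by (simp_all add: B_def powr_powr)
    have M: "real M \<le> B" "B \<le> real M + 1" using B unfolding M_def by linarith+
    define S1 where "S1 = (\<Sum>b=1..M. real b powr (- (3/2)))"
    define S2 where "S2 = (\<Sum>a=1..M. real a powr (- (2/3)))"
    define T1 where "T1 = (\<Sum>b=1..M. real (nat \<lfloor>(y / real b ^ 3) powr (1/2)\<rfloor>))"
    define T2 where "T2 = (\<Sum>a=1..M. real (nat \<lfloor>(y / real a ^ 2) powr (1/3)\<rfloor>))"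
    have "(\<Sum>b=1..M. (y / real b ^ 3) powr (1/2)) = y powr (1/2) * S1"
      unfolding S1_def sum_distrib_left using y
      by (intro sum.cong refl) (simp add: powr_divide powr_minus_divide powr_powr flip: powr_numeral)
    hence t1: "\<bar>T1 - y powr (1/2) * S1\<bar> \<le> B"
      using abs_sum_floor_le[of "{1..M}" "\<lambda>b. (y / real b ^ 3) powr (1/2)"] M unfolding T1_def by simp
    have "(\<Sum>a=1..M. (y / real a ^ 2) powr (1/3)) = y powr (1/3) * S2"
      unfolding S2_def sum_distrib_left using y
      by (intro sum.cong refl) (simp add: powr_divide powr_minus_divide powr_powr flip: powr_numeral)
    hence t2: "\<bar>T2 - y powr (1/3) * S2\<bar> \<le> B"
      using abs_sum_floor_le[of "{1..M}" "\<lambda>a. (y / real a ^ 2) powr (1/3)"] M unfolding T2_def by simp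
    have "\<bar>S1 + 2 * B powr (- (1/2)) - zeta_real (3/2)\<bar> \<le> 2 powr (5/2) * B powr (- (3/2))"
      using sum_powr_asymp[of "3/2" B] B by (simp add: S1_def M_def)
    hence "B powr (5/2) * \<bar>S1 + 2 * B powr (- (1/2)) - zeta_real (3/2)\<bar> \<le> B powr (5/2) * (2 powr (5/2) * B powr (- (3/2)))"
      by (intro mult_left_mono) auto
    also have "\<dots> = 2 powr (5/2) * B powr (5/2 + - (3/2))" unfolding powr_add by simp
    also have "B powr (5/2) * \<bar>S1 + 2 * B powr (- (1/2)) - zeta_real (3/2)\<bar>
        = \<bar>B powr (5/2) * S1 + 2 * (B powr (5/2) * B powr (- (1/2))) - zeta_real (3/2) * B powr (5/2)\<bar>"
      unfolding abs_scale[OF powr_ge_zero] by (simp add: algebra_simps)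
    also have "B powr (5/2) * B powr (- (1/2)) = B ^ 2" using B by (simp flip: powr_add powr_numeral)
    finally have s1: "\<bar>y powr (1/2) * S1 + 2 * B ^ 2 - zeta_real (3/2) * y powr (1/2)\<bar> \<le> 2 powr (5/2) * B"
      using B by (simp add: yB)
    have "\<bar>S2 - 3 * B powr (1/3) - zeta_real (2/3)\<bar> \<le> 2 powr (5/3) * B powr (- (2/3))"
      using sum_powr_asymp[of "2/3" B] B by (simp add: S2_def M_def mult.commute)
    hence "B powr (5/3) * \<bar>S2 - 3 * B powr (1/3) - zeta_real (2/3)\<bar> \<le> B powr (5/3) * (2 powr (5/3) * B powr (- (2/3)))"
      by (intro mult_left_mono) auto
    also have "\<dots> = 2 powr (5/3) * B powr (5/3 + - (2/3))" unfolding powr_add by simp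
    also have "B powr (5/3) * \<bar>S2 - 3 * B powr (1/3) - zeta_real (2/3)\<bar>
        = \<bar>B powr (5/3) * S2 - 3 * (B powr (5/3) * B powr (1/3)) - zeta_real (2/3) * B powr (5/3)\<bar>"
      unfolding abs_scale[OF powr_ge_zero] by (simp add: algebra_simps)
    also have "B powr (5/3) * B powr (1/3) = B ^ 2" using B by (simp flip: powr_add powr_numeral)
    finally have s2: "\<bar>y powr (1/3) * S2 - 3 * B ^ 2 - zeta_real (2/3) * y powr (1/3)\<bar> \<le> 2 powr (5/3) * B"
      using B by (simp add: yB)
    have "\<bar>B ^ 2 - real M ^ 2\<bar> \<le> 2 * B"
    proof -
      have "B ^ 2 - real M ^ 2 = (B - real M) * (B + real M)" by (simp add: power2_eq_square algebra_simps)
      moreover have "\<dots> \<le> 1 * (2 * B)" using M B by (intro mult_mono) auto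
      moreover have "(B - real M) * (B + real M) \<ge> 0" using M B by (intro mult_nonneg_nonneg) auto
      ultimately show ?thesis by linarith
    qed
    moreover have "real (card (lattice_points y)) = T1 + T2 - real M ^ 2"
      using card_lattice_points_decomposition[OF y] by (simp add: T1_def T2_def M_def B_def)
    ultimately have "\<bar>real (card (lattice_points y)) - zeta_real (3/2) * y powr (1/2) - zeta_real (2/3) * y powr (1/3)\<bar>
      \<le> B + B + 2 powr (5/2) * B + 2 powr (5/3) * B + 2 * B"
      using t1 t2 s1 s2 by linarith
    also have "\<dots> = K * B" by (simp add: K_def algebra_simps)
    finally show ?thesis by (simp add: B_def)
  qed
  thus thesis using that by blast
qed

text \<open>Write b = q d^2 with q squarefree; then a^2 b^3 = d^6 (a^2 q^3). Every square-full n is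
  uniquely a^2 q^3 with q squarefree, since the parity of an exponent 2t + 3s with s <= 1 determines
  s.\<close>

lemma bij_betw_lattice_points_squarefull:
  "bij_betw (\<lambda>(b, a). (square_part b, a ^ 2 * squarefree_part b ^ 3))
     (lattice_points y) (Sigma {d. d > 0 \<and> real d ^ 6 \<le> y} (\<lambda>d. {n \<in> exponents_in {2..}. real n \<le> y / real d ^ 6}))"
    (is "bij_betw ?f _ ?S")
proof (rule bij_betwI'[where X = "lattice_points y"])
  show "(?f u = ?f v) = (u = v)" if u: "u \<in> lattice_points y" and v: "v \<in> lattice_points y" for u v
  proof
    assume eq: "?f u = ?f v"
    obtain b a where ba: "u = (b, a)" "b > 0" "a > 0" using u by (auto simp: lattice_points_def)
    obtain b' a' where ba': "v = (b', a')" "b' > 0" "a' > 0" using v by (auto simp: lattice_points_def)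
    have eqs: "square_part b = square_part b'" "a ^ 2 * squarefree_part b ^ 3 = a' ^ 2 * squarefree_part b' ^ 3"
      using eq ba ba' by auto
    have "squarefree_part b = squarefree_part b'"
    proof (rule multiplicity_eq_nat)
      fix p :: nat assume p: "prime p"
      have "2 * multiplicity p a + 3 * multiplicity p (squarefree_part b) =
            2 * multiplicity p a' + 3 * multiplicity p (squarefree_part b')"
        using arg_cong[OF eqs(2), of "multiplicity p"] p ba ba'
        by (simp add: prime_elem_multiplicity_mult_distrib prime_elem_multiplicity_power_distrib)
      moreover have "multiplicity p (squarefree_part b) \<le> 1" "multiplicity p (squarefree_part b') \<le> 1"
        using p by (simp_all add: prime_multiplicity_squarefree_part_le_Suc_0)
      moreover have "s = s'" if "2 * t + 3 * s = 2 * t' + 3 * s'" "s \<le> 1" "s' \<le> 1" for s s' t t' :: nat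
        using that by presburger
      ultimately show "multiplicity p (squarefree_part b) = multiplicity p (squarefree_part b')" by blast
    qed (simp_all add: zero_less_iff_neq_zero)
    moreover from eqs(1) this have "b = b'" by (rule squarefree_decomposition_unique)
    moreover have "a ^ 2 = a' ^ 2" using eqs(2) unfolding calculation(1) by simp
    hence "a = a'" by (simp add: power_eq_iff_eq_base)
    ultimately show "u = v" using ba ba' by simp
  qed auto
  have product: "a ^ 2 * b ^ 3 = square_part b ^ 6 * (a ^ 2 * squarefree_part b ^ 3)" for a b :: nat
  proof -
    have "a ^ 2 * b ^ 3 = a ^ 2 * (squarefree_part b * square_part b ^ 2) ^ 3"
      by (rule arg_cong[OF squarefree_decompose[of b], of "\<lambda>t. a ^ 2 * t ^ 3"])
    also have "\<dots> = square_part b ^ 6 * (a ^ 2 * squarefree_part b ^ 3)"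
      by (simp add: power_mult_distrib mult_ac flip: power_mult)
    finally show ?thesis .
  qed
  show "?f u \<in> ?S" if u: "u \<in> lattice_points y" for u
  proof -
    obtain b a where ba: "u = (b, a)" "b > 0" "a > 0" "real (a ^ 2 * b ^ 3) \<le> y"
      using u by (auto simp: lattice_points_def)
    define d n where "d = square_part b" and "n = a ^ 2 * squarefree_part b ^ 3"
    have d: "d > 0" using ba by (auto simp: d_def intro: gr0I)
    have n: "n > 0" using ba by (auto simp: n_def intro: gr0I)
    have le: "real d ^ 6 * real n \<le> y" using ba(4) unfolding product[of a b] d_def n_def by simp
    have "real d ^ 6 * 1 \<le> real d ^ 6 * real n" using n by (intro mult_left_mono) auto
    hence "real d ^ 6 \<le> y" using le by simp
    moreover have "real n \<le> y / real d ^ 6" using le d by (simp add: pos_le_divide_eq mult.commute)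
    moreover have "n \<in> exponents_in {2..}"
    proof -
      have "multiplicity p n = 2 * multiplicity p a + 3 * multiplicity p (squarefree_part b)" if "prime p" for p
        using that ba unfolding n_def
        by (simp add: prime_elem_multiplicity_mult_distrib prime_elem_multiplicity_power_distrib)
      thus ?thesis using n unfolding exponents_in_def by auto
    qed
    ultimately have "(d, n) \<in> ?S" using d by simp
    thus ?thesis by (simp add: ba(1) d_def n_def)
  qed
  show "\<exists>u\<in>lattice_points y. z = ?f u" if z: "z \<in> ?S" for z
  proof -
    obtain d n where dn: "z = (d, n)" "d > 0" "n \<in> exponents_in {2..}" "real n \<le> y / real d ^ 6"
      using z by auto
    have n: "n > 0" using dn exponents_in_pos by auto
    define q where "q = squarefree_part n"
    have q: "squarefree q" "q > 0" by (auto simp: q_def intro: gr0I)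
    \<comment> \<open>An exponent e of n contributes e mod 2 to q and e div 2 to the square part,
      and e mod 2 <= e div 2 because e is never 1. So an odd exponent leaves room for the cube of
      the prime.\<close>
    have "q dvd square_part n"
    proof (rule multiplicity_le_imp_dvd)
      fix p :: nat assume p: "prime p"
      have "multiplicity p n = 0 \<or> multiplicity p n \<ge> 2" using multiplicity_exponents_in[OF dn(3) p] by auto
      hence "multiplicity p n mod 2 \<le> multiplicity p n div 2" by auto
      thus "multiplicity p q \<le> multiplicity p (square_part n)"
        using p by (simp add: q_def prime_multiplicity_squarefree_part prime_multiplicity_square_part)
    qed (use q n in auto)
    then obtain a where a: "square_part n = q * a" by blast
    have apos: "a > 0" using a n by (auto intro: gr0I)
    have n_eq: "n = a ^ 2 * q ^ 3"
      using squarefree_decompose[of n] unfolding a q_def[symmetric]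
      by (simp add: power_mult_distrib power2_eq_square power3_eq_cube mult_ac)
    define b where "b = q * d ^ 2"
    have b: "b > 0" using q dn by (simp add: b_def)
    have qmult: "multiplicity p q \<le> 1" if "prime p" for p
      using q that by (simp add: squarefree_factorial_semiring'')
    have sq: "square_part b = d"
    proof (rule multiplicity_eq_nat)
      fix p :: nat assume p: "prime p"
      have "multiplicity p b = multiplicity p q + 2 * multiplicity p d"
        unfolding b_def using p q dn by (simp add: multiplicity_mult_power)
      thus "multiplicity p (square_part b) = multiplicity p d"
        using p qmult[OF p] by (simp add: prime_multiplicity_square_part)
    qed (use b dn in \<open>auto intro: gr0I\<close>)
    have "squarefree_part b * square_part b ^ 2 = q * d ^ 2"
      using squarefree_decompose[of b] by (simp add: b_def)
    hence sqf: "squarefree_part b = q" using dn unfolding sq by simp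
    have "a ^ 2 * b ^ 3 = d ^ 6 * n" unfolding product[of a b] sq sqf n_eq ..
    hence "real (a ^ 2 * b ^ 3) = real n * real d ^ 6" by (metis mult.commute of_nat_mult of_nat_power)
    also have "\<dots> \<le> y" using dn by (simp add: pos_le_divide_eq)
    finally have "(b, a) \<in> lattice_points y" using b apos by (simp add: lattice_points_def)
    moreover have "z = ?f (b, a)" by (simp add: dn(1) sq sqf n_eq)
    ultimately show ?thesis by blast
  qed
qed

lemma sixth_powers_le_eq: "y \<ge> 0 \<Longrightarrow> {d. d > 0 \<and> real d ^ 6 \<le> y} = {1..nat \<lfloor>y powr (1/6)\<rfloor>}"
  using mult_power_le_eq[of y 6 1] by simp

text \<open>Coefficient form of zeta(2s) zeta(3s) = zeta(6s) F(s), with F the Dirichlet series of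
  the square-full numbers.\<close>

lemma card_lattice_points_eq_sum:
  assumes "y \<ge> 0"
  shows "real (card (lattice_points y))
    = (\<Sum>d | d > 0 \<and> real d ^ 6 \<le> y. real (card {n \<in> exponents_in {2..}. real n \<le> y / real d ^ 6}))"
proof -
  have "card (lattice_points y) = (\<Sum>d | d > 0 \<and> real d ^ 6 \<le> y. card {n \<in> exponents_in {2..}. real n \<le> y / real d ^ 6})"
    unfolding bij_betw_same_card[OF bij_betw_lattice_points_squarefull]
    by (intro card_SigmaI ballI finite_nat_le_real) (simp add: sixth_powers_le_eq[OF assms])
  thus ?thesis by simp
qed

text \<open>Inverting the error term rather than the counting function itself avoids evaluating
  \<open>\<Sum>d. \<mu>(d) / d ^ s\<close>.\<close>
lemma card_squarefull_asymp:
  obtains K where "\<And>x. x \<ge> 1 \<Longrightarrow> \<bar>real (card {n \<in> exponents_in {2..}. real n \<le> x})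
    - zeta_real (3/2) / zeta_real 3 * x powr (1/2) - zeta_real (2/3) / zeta_real 2 * x powr (1/3)\<bar> \<le> K * x powr (1/5)"
proof -
  define \<alpha> \<beta> where "\<alpha> = zeta_real (3/2) / zeta_real 3" and "\<beta> = zeta_real (2/3) / zeta_real 2"
  have \<alpha>\<beta>: "\<alpha> * zeta_real 3 = zeta_real (3/2)" "\<beta> * zeta_real 2 = zeta_real (2/3)"
    using zeta_real_pos[of 3] zeta_real_pos[of 2] by (auto simp: \<alpha>_def \<beta>_def)
  obtain K0 where K0: "\<And>y. y \<ge> 1 \<Longrightarrow> \<bar>real (card (lattice_points y))
    - zeta_real (3/2) * y powr (1/2) - zeta_real (2/3) * y powr (1/3)\<bar> \<le> K0 * y powr (1/5)"
    using card_lattice_points_asymp by blast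
  define E where "E = (\<lambda>y. real (card {n \<in> exponents_in {2..}. real n \<le> y}) - \<alpha> * y powr (1/2) - \<beta> * y powr (1/3))"
  define R where "R = (\<lambda>y. \<Sum>d | d > 0 \<and> real d ^ 6 \<le> y. E (y / real d ^ 6))"
  \<comment> \<open>With z = y^(1/6), the cut-off for d, \<open>sum_powr_asymp\<close> gives 16 /
    z^3 at s = 3 and 8 / z^2 at s = 2. Adding the antiderivative terms 1 / (2 z^2) and 1 / z yields
    33/2 and 9.\<close>
  define K1 where "K1 = K0 + \<bar>\<alpha>\<bar> * (33/2) + \<bar>\<beta>\<bar> * 9"
  have R_le: "\<bar>R y\<bar> \<le> K1 * y powr (1/5)" if y: "y \<ge> 1" for y
  proof -
    define z where "z = y powr (1/6)"
    have z: "z \<ge> 1" using y by (simp add: z_def ge_one_powr_ge_zero)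
    have yz: "y powr (1/2) = z ^ 3" "y powr (1/3) = z ^ 2"
      using y by (simp_all add: z_def powr_powr flip: powr_numeral)
    have zpow: "z powr (-1) = 1 / z" "z powr (-2) = 1 / z ^ 2" "z powr (-3) = 1 / z ^ 3"
      using z by (simp_all add: powr_minus_divide)
    define S3 where "S3 = (\<Sum>d=1..nat \<lfloor>z\<rfloor>. real d powr (-3))"
    define S2 where "S2 = (\<Sum>d=1..nat \<lfloor>z\<rfloor>. real d powr (-2))"
    have set: "{d. d > 0 \<and> real d ^ 6 \<le> y} = {1..nat \<lfloor>z\<rfloor>}"
      using sixth_powers_le_eq y by (simp add: z_def)
    have "R y = real (card (lattice_points y)) - (\<Sum>d=1..nat \<lfloor>z\<rfloor>. \<alpha> * (y / real d ^ 6) powr (1/2))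
        - (\<Sum>d=1..nat \<lfloor>z\<rfloor>. \<beta> * (y / real d ^ 6) powr (1/3))"
      using card_lattice_points_eq_sum[of y] y unfolding R_def E_def set by (simp add: sum_subtractf)
    also have "(\<Sum>d=1..nat \<lfloor>z\<rfloor>. \<alpha> * (y / real d ^ 6) powr (1/2)) = \<alpha> * y powr (1/2) * S3"
      unfolding S3_def sum_distrib_left using y
      by (intro sum.cong refl) (simp add: powr_divide powr_minus_divide powr_powr flip: powr_numeral)
    also have "(\<Sum>d=1..nat \<lfloor>z\<rfloor>. \<beta> * (y / real d ^ 6) powr (1/3)) = \<beta> * y powr (1/3) * S2"
      unfolding S2_def sum_distrib_left using y
      by (intro sum.cong refl) (simp add: powr_divide powr_minus_divide powr_powr flip: powr_numeral)
    finally have Ry: "R y = real (card (lattice_points y)) - \<alpha> * y powr (1/2) * S3 - \<beta> * y powr (1/3) * S2" .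
    have "\<bar>S3 - zeta_real 3\<bar> \<le> (33/2) * (1 / z ^ 2)"
    proof -
      have "\<bar>S3 + 1 / z ^ 2 / 2 - zeta_real 3\<bar> \<le> 16 * (1 / z ^ 3)"
        using sum_powr_asymp[of 3 z] z by (simp add: S3_def zpow)
      moreover have "1 / z ^ 3 \<le> 1 / z ^ 2" using z by (intro divide_left_mono power_increasing) auto
      moreover have "1 / z ^ 2 > 0" using z by simp
      moreover define u v where "u = 1 / z ^ 2" and "v = 1 / z ^ 3"
      ultimately show ?thesis unfolding u_def[symmetric] v_def[symmetric] by linarith
    qed
    hence "z ^ 3 * \<bar>S3 - zeta_real 3\<bar> \<le> z ^ 3 * ((33/2) * (1 / z ^ 2))" using z by (intro mult_left_mono) auto
    also have "\<dots> = (33/2) * z" using z by (simp add: power3_eq_cube power2_eq_square)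
    finally have s3: "z ^ 3 * \<bar>S3 - zeta_real 3\<bar> \<le> (33/2) * z" .
    have "\<bar>S2 - zeta_real 2\<bar> \<le> 9 * (1 / z)"
    proof -
      have "\<bar>S2 + 1 / z - zeta_real 2\<bar> \<le> 8 * (1 / z ^ 2)"
        using sum_powr_asymp[of 2 z] z by (simp add: S2_def zpow)
      moreover have "1 / z ^ 2 \<le> 1 / z ^ 1" using z by (intro divide_left_mono power_increasing) auto
      hence "1 / z ^ 2 \<le> 1 / z" by simp
      moreover have "1 / z > 0" using z by simp
      moreover define u v where "u = 1 / z" and "v = 1 / z ^ 2"
      ultimately show ?thesis unfolding u_def[symmetric] v_def[symmetric] by linarith
    qed
    hence "z ^ 2 * \<bar>S2 - zeta_real 2\<bar> \<le> z ^ 2 * (9 * (1 / z))" using z by (intro mult_left_mono) auto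
    also have "\<dots> = 9 * z" using z by (simp add: power2_eq_square)
    finally have s2: "z ^ 2 * \<bar>S2 - zeta_real 2\<bar> \<le> 9 * z" .
    \<comment> \<open>The choice of alpha and beta makes the main terms of the lattice count cancel
      against the completed sums over d. What remains is the lattice error and the truncation
      errors, which are O(z).\<close>
    have "R y = (real (card (lattice_points y)) - zeta_real (3/2) * y powr (1/2) - zeta_real (2/3) * y powr (1/3))
        - \<alpha> * (z ^ 3 * (S3 - zeta_real 3)) - \<beta> * (z ^ 2 * (S2 - zeta_real 2))"
      unfolding Ry yz \<alpha>\<beta>[symmetric] by (simp add: algebra_simps)
    also have "\<bar>\<dots>\<bar> \<le> K0 * y powr (1/5) + \<bar>\<alpha>\<bar> * ((33/2) * z) + \<bar>\<beta>\<bar> * (9 * z)"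
    proof -
      have "\<bar>\<alpha> * (z ^ 3 * (S3 - zeta_real 3))\<bar> \<le> \<bar>\<alpha>\<bar> * ((33/2) * z)"
        using s3 z by (simp only: abs_mult power_abs) (intro mult_left_mono, simp_all)
      moreover have "\<bar>\<beta> * (z ^ 2 * (S2 - zeta_real 2))\<bar> \<le> \<bar>\<beta>\<bar> * (9 * z)"
        using s2 z by (simp only: abs_mult power_abs) (intro mult_left_mono, simp_all)
      ultimately show ?thesis using K0[OF y] by linarith
    qed
    also have "\<dots> \<le> K0 * y powr (1/5) + \<bar>\<alpha>\<bar> * ((33/2) * y powr (1/5)) + \<bar>\<beta>\<bar> * (9 * y powr (1/5))"
      using y unfolding z_def by (intro add_mono mult_left_mono powr_mono order_refl) auto
    also have "\<dots> = K1 * y powr (1/5)" by (simp add: K1_def algebra_simps)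
    finally show ?thesis .
  qed
  have "K1 \<ge> 0" using R_le[of 1] by (simp add: abs_le_iff)
  \<comment> \<open>Inverting a bound (x / d^6)^(1/5) produces d^(-6/5). The series converges
    because 1/5 exceeds 1/6.\<close>
  define L where "L = (\<Sum>d. real d powr (- (6/5)))"
  have summable: "summable (\<lambda>d. real d powr (- (6/5)))" by (simp add: summable_real_powr_iff)
  have "\<bar>E x\<bar> \<le> (K1 * L) * x powr (1/5)" if x: "x \<ge> 1" for x
  proof -
    define D where "D = {d. d > 0 \<and> real d ^ 6 \<le> x}"
    have D: "finite D" using sixth_powers_le_eq[of x] x by (simp add: D_def)
    have "E x = (\<Sum>d\<in>D. moebius_mu d * R (x / real d ^ 6))"
      unfolding D_def by (rule moebius_inversion_sixth_powers[OF _ x]) (simp add: R_def)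
    also have "\<bar>\<dots>\<bar> \<le> (\<Sum>d\<in>D. \<bar>moebius_mu d * R (x / real d ^ 6)\<bar>)" by (rule sum_abs)
    also have "\<dots> \<le> (\<Sum>d\<in>D. K1 * x powr (1/5) * real d powr (- (6/5)))"
    proof (rule sum_mono)
      fix d assume d: "d \<in> D"
      hence "x / real d ^ 6 \<ge> 1" by (simp add: D_def)
      from R_le[OF this] have "\<bar>moebius_mu d * R (x / real d ^ 6)\<bar> \<le> 1 * (K1 * (x / real d ^ 6) powr (1/5))"
        unfolding abs_mult by (intro mult_mono abs_moebius_mu_le_1) auto
      also have "(x / real d ^ 6) powr (1/5) = x powr (1/5) * real d powr (- (6/5))"
        using d x by (simp add: D_def powr_divide powr_minus_divide powr_powr flip: powr_numeral)
      finally show "\<bar>moebius_mu d * R (x / real d ^ 6)\<bar> \<le> K1 * x powr (1/5) * real d powr (- (6/5))" by simp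
    qed
    also have "\<dots> = K1 * x powr (1/5) * (\<Sum>d\<in>D. real d powr (- (6/5)))" by (simp add: sum_distrib_left)
    also have "\<dots> \<le> K1 * x powr (1/5) * L"
      unfolding L_def using \<open>K1 \<ge> 0\<close> D summable by (intro mult_left_mono sum_le_suminf) auto
    finally show ?thesis by (simp add: mult_ac)
  qed
  thus thesis using that unfolding E_def \<alpha>_def \<beta>_def by blast
qed

section \<open>The mean square of the minimum exponent\<close>

text \<open>The case n = 1 has to be excluded: 1 is vacuously k-full for all k, whereas m(1) = 1 by
  convention.\<close>

lemma min_exponent_ge_iff:
  assumes "n > 1" "k > 0"
  shows "k \<le> min_exponent n \<longleftrightarrow> n \<in> exponents_in {k..}"
proof -
  have "prime_factors n \<noteq> {}" using assms by (auto simp: prime_factorization_empty_iff)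
  hence "k \<le> min_exponent n \<longleftrightarrow> (\<forall>p\<in>prime_factors n. k \<le> multiplicity p n)"
    using assms by (simp add: min_exponent_def)
  also have "\<dots> \<longleftrightarrow> n \<in> exponents_in {k..}"
    using assms by (auto simp: exponents_in_def prime_factors_multiplicity)
  finally show ?thesis .
qed

text \<open>For any prime p dividing n, p^m(n) divides n, so 2^m(n) <= n <= x. At n = 1 the bound 1
  <= log 2 x comes from x > 2.\<close>

lemma min_exponent_le_log:
  assumes "n > 0" "real n \<le> x" "x > 2"
  shows "real (min_exponent n) \<le> log 2 x"
proof (cases "n > 1")
  case True
  then obtain p where p: "prime p" "p dvd n" using prime_factor_nat[of n] by auto
  have "n \<in> exponents_in {min_exponent n..} \<or> min_exponent n = 0"
    using min_exponent_ge_iff[OF True, of "min_exponent n"] by auto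
  moreover have "multiplicity p n > 0" using p True by (simp add: prime_multiplicity_gt_zero_iff)
  ultimately have "min_exponent n \<le> multiplicity p n"
    using multiplicity_exponents_in[of n "{min_exponent n..}" p] p by auto
  hence "p ^ min_exponent n dvd n" by (rule multiplicity_dvd')
  hence "p ^ min_exponent n \<le> n" using True by (intro dvd_imp_le) auto
  moreover have "2 ^ min_exponent n \<le> p ^ min_exponent n" using p prime_ge_2_nat by (intro power_mono) auto
  ultimately have "2 ^ min_exponent n \<le> n" by linarith
  hence "real (2 ^ min_exponent n) \<le> real n" by (rule of_nat_mono)
  also have "real (2 ^ min_exponent n) = 2 powr real (min_exponent n)" by (simp add: powr_realpow)
  finally have "2 powr real (min_exponent n) \<le> x" using assms by linarith
  thus ?thesis using assms by (simp add: le_log_iff)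
qed (use assms in \<open>simp add: min_exponent_def le_log_iff\<close>)

text \<open>The partial sums 1, 1 + 3, 1 + 3 + 5 are the squares for m = 1, 2, 3. The 16 covers the
  defect 16 - 9 = 7 at m = 4 and also n = 1, where all indicators are 1 and the defect is 8.\<close>

lemma min_exponent_sq_approx:
  assumes n: "n > 0" "real n \<le> x" "x > 2"
  shows "\<bar>real ((min_exponent n)\<^sup>2) - 1 - 3 * of_bool (n \<in> exponents_in {2..}) - 5 * of_bool (n \<in> exponents_in {3..})\<bar>
    \<le> 16 * of_bool (n \<in> exponents_in {4..}) + (log 2 x)\<^sup>2 * of_bool (n \<in> exponents_in {5..})"
proof (cases "n = 1")
  case True
  have "1 \<in> exponents_in E" for E by (simp add: exponents_in_def)
  thus ?thesis using True by (simp add: min_exponent_def)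
next
  case False
  hence n1: "n > 1" using n by simp
  define m where "m = min_exponent n"
  have "n \<in> exponents_in {1..}" using n by (auto simp: exponents_in_def)
  hence m1: "m \<ge> 1" using min_exponent_ge_iff[OF n1, of 1] by (simp add: m_def)
  have iff: "n \<in> exponents_in {k..} \<longleftrightarrow> k \<le> m" if "k > 0" for k
    using min_exponent_ge_iff[OF n1 that] by (simp add: m_def)
  have sq: "(real m)\<^sup>2 \<le> (log 2 x)\<^sup>2" using min_exponent_le_log[OF n] by (intro power_mono) (auto simp: m_def)
  consider "m = 1" | "m = 2" | "m = 3" | "m = 4" | "m \<ge> 5" using m1 by linarith
  thus ?thesis
  proof cases
    case 5
    \<comment> \<open>Since m^2 >= 25, the quantity inside the absolute value is m^2 - 9 >= 0, at
      most m^2.\<close>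
    have "(5::real)\<^sup>2 \<le> (real m)\<^sup>2" using 5 by (intro power_mono) auto
    thus ?thesis using 5 sq by (simp add: iff flip: m_def)
  qed (simp_all add: iff flip: m_def)
qed

text \<open>The exponent 1/20 = 1/4 - 1/5 is what the count of 5-full numbers leaves free; its half
  1/40 is used before squaring.\<close>

lemma log_sq_le_powr:
  assumes "x \<ge> 1"
  shows "(log 2 x)\<^sup>2 \<le> (40 / ln 2)\<^sup>2 * x powr (1/20)"
proof -
  have "ln x \<le> x powr (1/40) / (1/40)" using assms by (intro ln_powr_bound) auto
  hence "log 2 x \<le> (40 / ln 2) * x powr (1/40)" by (simp add: log_def field_simps)
  hence "(log 2 x)\<^sup>2 \<le> ((40 / ln 2) * x powr (1/40))\<^sup>2" using assms by (intro power_mono) auto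
  also have "\<dots> = (40 / ln 2)\<^sup>2 * (x powr (1/40))\<^sup>2" by (rule power_mult_distrib)
  also have "(x powr (1/40))\<^sup>2 = x powr (1/20)" using assms by (simp add: powr_power)
  finally show ?thesis .
qed

text \<open>Summing the pointwise approximation turns indicators into counts. N_3 and N_4 contribute
  errors x^(1/4), N_2 contributes x^(1/5), the logarithmic part x^(1/20 + 1/5), and the number of n
  <= x differs from x by at most 1.\<close>

lemma sum_min_exponent_sq_asymp:
  obtains C where "\<And>x. x > 2 \<Longrightarrow>
    \<bar>real (\<Sum>n | 1 \<le> n \<and> real n \<le> x. (min_exponent n)\<^sup>2) - (x + 3 * (zeta_real (3/2) / zeta_real 3) * x powr (1/2)
      + (3 * (zeta_real (2/3) / zeta_real 2) + 5 * gamma_0_3) * x powr (1/3))\<bar> \<le> C * x powr (1/4)"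
proof -
  define N where "N = (\<lambda>k x. real (card {n \<in> exponents_in {k..}. real n \<le> x}))"
  define \<alpha> \<beta> where "\<alpha> = zeta_real (3/2) / zeta_real 3" and "\<beta> = zeta_real (2/3) / zeta_real 2"
  obtain K2 where K2: "\<And>x. x \<ge> 1 \<Longrightarrow> \<bar>N 2 x - \<alpha> * x powr (1/2) - \<beta> * x powr (1/3)\<bar> \<le> K2 * x powr (1/5)"
    unfolding N_def \<alpha>_def \<beta>_def using card_squarefull_asymp by blast
  obtain K3 where K3: "\<And>x. x \<ge> 1 \<Longrightarrow> \<bar>N 3 x - gamma_0_3 * x powr (1/3)\<bar> \<le> K3 * x powr (1/4)"
    unfolding N_def using card_cubefull_asymp by blast
  obtain K4 where "\<And>x. x \<ge> 0 \<Longrightarrow> N 4 x \<le> K4 * x powr (1 / real 4)"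
    unfolding N_def using card_full_le[of 4] by auto
  hence K4: "\<And>x. x \<ge> 0 \<Longrightarrow> N 4 x \<le> K4 * x powr (1/4)" by simp
  obtain K5 where "\<And>x. x \<ge> 0 \<Longrightarrow> N 5 x \<le> K5 * x powr (1 / real 5)"
    unfolding N_def using card_full_le[of 5] by auto
  hence K5: "\<And>x. x \<ge> 0 \<Longrightarrow> N 5 x \<le> K5 * x powr (1/5)" by simp
  \<comment> \<open>At x = 1 the bound reads as an absolute value below \<open>K2\<close>. The sign
    is used to weaken x^(1/5) to x^(1/4).\<close>
  have "K2 \<ge> 0" using K2[of 1] by simp
  have "\<bar>real (\<Sum>n | 1 \<le> n \<and> real n \<le> x. (min_exponent n)\<^sup>2) - (x + 3 * \<alpha> * x powr (1/2)
      + (3 * \<beta> + 5 * gamma_0_3) * x powr (1/3))\<bar> \<le> (1 + 3 * K2 + 5 * K3 + 16 * K4 + (40 / ln 2)\<^sup>2 * K5) * x powr (1/4)"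
    if x: "x > 2" for x
  proof -
    define X where "X = {n. 1 \<le> n \<and> real n \<le> x}"
    have X: "X = {1..nat \<lfloor>x\<rfloor>}" using x by (auto simp: X_def le_nat_iff le_floor_iff)
    have sum_ind: "(\<Sum>n\<in>X. of_bool (n \<in> exponents_in {k..})) = N k x" for k
    proof -
      have "X \<inter> {n. n \<in> exponents_in {k..}} = {n \<in> exponents_in {k..}. real n \<le> x}"
        using exponents_in_pos by (auto simp: X_def Suc_le_eq)
      thus ?thesis by (simp add: sum_of_bool_eq X N_def)
    qed
    define Q where "Q = real (\<Sum>n\<in>X. (min_exponent n)\<^sup>2)"
    have "Q - real (card X) - 3 * N 2 x - 5 * N 3 x = (\<Sum>n\<in>X. real ((min_exponent n)\<^sup>2) - 1
        - 3 * of_bool (n \<in> exponents_in {2..}) - 5 * of_bool (n \<in> exponents_in {3..}))"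
      unfolding Q_def sum_subtractf sum_distrib_left[symmetric] sum_ind by simp
    also have "\<bar>\<dots>\<bar> \<le> (\<Sum>n\<in>X. \<bar>real ((min_exponent n)\<^sup>2) - 1
        - 3 * of_bool (n \<in> exponents_in {2..}) - 5 * of_bool (n \<in> exponents_in {3..})\<bar>)" by (rule sum_abs)
    also have "\<dots> \<le> (\<Sum>n\<in>X. 16 * of_bool (n \<in> exponents_in {4..}) + (log 2 x)\<^sup>2 * of_bool (n \<in> exponents_in {5..}))"
      using x by (intro sum_mono min_exponent_sq_approx) (auto simp: X_def)
    also have "\<dots> = 16 * N 4 x + (log 2 x)\<^sup>2 * N 5 x"
      unfolding sum.distrib sum_distrib_left[symmetric] sum_ind ..
    also have "(log 2 x)\<^sup>2 * N 5 x \<le> (40 / ln 2)\<^sup>2 * x powr (1/20) * (K5 * x powr (1/5))"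
      using x by (intro mult_mono log_sq_le_powr K5) (auto simp: N_def)
    also have "\<dots> = (40 / ln 2)\<^sup>2 * K5 * x powr (1/20 + 1/5)" unfolding powr_add by simp
    finally have main: "\<bar>Q - real (card X) - 3 * N 2 x - 5 * N 3 x\<bar> \<le> 16 * N 4 x + (40 / ln 2)\<^sup>2 * K5 * x powr (1/4)"
      by simp
    have "\<bar>real (card X) - x\<bar> \<le> 1" unfolding X using x by simp linarith
    moreover have "1 \<le> x powr (1/4)" using x by (simp add: ge_one_powr_ge_zero)
    moreover have "K2 * x powr (1/5) \<le> K2 * x powr (1/4)"
      using x \<open>K2 \<ge> 0\<close> by (intro mult_left_mono powr_mono) auto
    ultimately have "\<bar>Q - (x + 3 * \<alpha> * x powr (1/2) + (3 * \<beta> + 5 * gamma_0_3) * x powr (1/3))\<bar> 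
        \<le> x powr (1/4) + 3 * (K2 * x powr (1/4)) + 5 * (K3 * x powr (1/4)) + 16 * (K4 * x powr (1/4)) + (40 / ln 2)\<^sup>2 * K5 * x powr (1/4)"
      using main K2[of x] K3[of x] K4[of x] x by (simp add: abs_le_iff algebra_simps)
    thus ?thesis by (simp add: Q_def X_def algebra_simps)
  qed
  thus thesis using that unfolding \<alpha>_def \<beta>_def by blast
qed

theorem theorem1p1:
  "\<exists>C::real. \<forall>x::real. x > 2 \<longrightarrow>
     norm (of_nat (\<Sum>n | 1 \<le> n \<and> real n \<le> x. (min_exponent n)\<^sup>2)
           - (of_real x
              + 3 * gamma_0_2 * of_real (x powr (1 / 2))
              + (3 * gamma_1_2 + 5 * of_real gamma_0_3) * of_real (x powr (1 / 3))))
       \<le> C * x powr (1 / 4)"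
proof -
  \<comment> \<open>All four zeta values are real, so the complex norm in the claim is the absolute
    value of a real number.\<close>
  have zeta: "gamma_0_2 = of_real (zeta_real (3/2) / zeta_real 3)"
    "gamma_1_2 = of_real (zeta_real (2/3) / zeta_real 2)"
    using riemann_zeta_of_real[of "3/2"] riemann_zeta_of_real[of 3]
      riemann_zeta_of_real[of "2/3"] riemann_zeta_of_real[of 2]
    by (simp_all add: gamma_0_2_def gamma_1_2_def)
  obtain C where C: "\<And>x. x > 2 \<Longrightarrow>
    \<bar>real (\<Sum>n | 1 \<le> n \<and> real n \<le> x. (min_exponent n)\<^sup>2) - (x + 3 * (zeta_real (3/2) / zeta_real 3) * x powr (1/2)
      + (3 * (zeta_real (2/3) / zeta_real 2) + 5 * gamma_0_3) * x powr (1/3))\<bar> \<le> C * x powr (1/4)"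
    using sum_min_exponent_sq_asymp by blast
  have "norm (of_nat (\<Sum>n | 1 \<le> n \<and> real n \<le> x. (min_exponent n)\<^sup>2)
           - (of_real x + 3 * gamma_0_2 * of_real (x powr (1 / 2))
              + (3 * gamma_1_2 + 5 * of_real gamma_0_3) * of_real (x powr (1 / 3)))) \<le> C * x powr (1 / 4)"
    if "x > 2" for x
  proof -
    define Q where "Q = (\<Sum>n | 1 \<le> n \<and> real n \<le> x. (min_exponent n)\<^sup>2)"
    have "of_nat Q - (of_real x + 3 * gamma_0_2 * of_real (x powr (1 / 2))
              + (3 * gamma_1_2 + 5 * of_real gamma_0_3) * of_real (x powr (1 / 3))) =
      complex_of_real (real Q - (x + 3 * (zeta_real (3/2) / zeta_real 3) * x powr (1/2)
      + (3 * (zeta_real (2/3) / zeta_real 2) + 5 * gamma_0_3) * x powr (1/3)))"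
      unfolding zeta by simp
    thus ?thesis using C[OF that] unfolding Q_def[symmetric] by (simp only: norm_of_real)
  qed
  thus ?thesis by blast
qed

end
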